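(* For each $n\ge2$ let $X=X^{(n)}$ be a random variable with values in $\{2,\dots,n\}$, let $Y$ be its size-biased version and $\mu=\mathbb E[\log Y]=\mathbb E[X\log X]/\mathbb E[X]$. Assume that $\mu/\log n\to0$ as $n\to\infty$ and that $\log Y$ satisfies the weak law of large numbers $$\lim_{n\to\infty}\mathbb P\bigg(\bigg|\frac1{\log n}\sum_{s=1}^{\lfloor\mu^{-1}\log n\rfloor}(\log Y_s-\mu)\bigg|>\delta\bigg)=0\qquad\text{for all }\delta>0,$$ where $Y_1,Y_2,\dots$ are i.i.d. copies of $Y$. Then the $X$-Block Average process started from a Dirac mass has cutoff at the time $t_{\rm ent}=\frac{n\log n}{\mathbb E[X\log X]}$: for every $\varepsilon\in(0,1)$, $t_{\rm mix}(\varepsilon)/t_{\rm ent}\to1$ as $n\to\infty$.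
   Context: Let $V=\{1,\dots,n\}$ and let $\Delta$ be the set of probability vectors on $V$. For $A\subset V$ and $\eta\in\Delta$, let $\varPsi_A\eta(x)=\frac1{|A|}\sum_{y\in A}\eta(y)$ if $x\in A$ and $\varPsi_A\eta(x)=\eta(x)$ if $x\notin A$. Given the law of $X$ (which may depend on $n$), let $X_1,X_2,\dots$ be i.i.d. copies of $X$ and, independently for each $t$, given $X_t$ let $A_t$ be a uniformly random subset of $V$ with $|A_t|=X_t$. The $X$-Block Average process started from $\eta_0$ is $\eta_t=\varPsi_{A_t}\cdots\varPsi_{A_1}\eta_0$; here $\eta_0$ is the Dirac mass at some $x_0\in V$. Let $\pi(x)\equiv 1/n$, $\|v\|_{\rm TV}=\frac12\sum_{x\in V}|v(x)|$, $d_{\rm TV}(t)=\|\eta_t-\pi\|_{\rm TV}$ (a random variable), and $t_{\rm mix}(\varepsilon)=\inf\{t\in\mathbb N:\ \mathbb E[d_{\rm TV}(t)]<\varepsilon\}$. The size-biased version $Y$ of $X$ has law $\mathbb P(Y=k)=k\,\mathbb P(X=k)/\mathbb E[X]$, $k\in\{2,\dots,n\}$. Logarithms are natural; $X$, $Y$, $\mu$ all may depend on $n$. *)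

theory Defs
  imports "HOL-Probability.Probability"
begin

text \<open>The vertex set is \<open>V = {1..n}\<close>; a vector on \<open>V\<close> is a function \<open>nat \<Rightarrow> real\<close>, of which only
  the values on \<open>{1..n}\<close> matter. The law of \<open>X\<close> is a \<open>nat pmf\<close>.\<close>

definition block_avg :: "nat set \<Rightarrow> (nat \<Rightarrow> real) \<Rightarrow> nat \<Rightarrow> real" where
  "block_avg A \<eta> x = (if x \<in> A then (\<Sum>y\<in>A. \<eta> y) / real (card A) else \<eta> x)"

definition dirac :: "nat \<Rightarrow> nat \<Rightarrow> real" where
  "dirac x\<^sub>0 x = (if x = x\<^sub>0 then 1 else 0)"

definition tv_norm :: "nat \<Rightarrow> (nat \<Rightarrow> real) \<Rightarrow> real" where
  "tv_norm n v = (1 / 2) * (\<Sum>x\<in>{1..n}. \<bar>v x\<bar>)"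

text \<open>Joint law of a pair \<open>(X\<^sub>t, A\<^sub>t)\<close>. The support of \<open>p\<close> is meant to be contained in \<open>{0..n}\<close>,
  so that the sets sampled from are nonempty.\<close>

definition step_pmf :: "nat \<Rightarrow> nat pmf \<Rightarrow> (nat \<times> nat set) pmf" where
  "step_pmf n p =
     bind_pmf p (\<lambda>k. map_pmf (Pair k) (pmf_of_set {A. A \<subseteq> {1..n} \<and> card A = k}))"

text \<open>Canonical space of i.i.d. sequences. Times start at 1; coordinate 0 is never used.\<close>

definition iid_seq :: "'a pmf \<Rightarrow> (nat \<Rightarrow> 'a) measure" where
  "iid_seq p = PiM UNIV (\<lambda>_. measure_pmf p)"

primrec block_process :: "nat \<Rightarrow> (nat \<Rightarrow> nat \<times> nat set) \<Rightarrow> nat \<Rightarrow> nat \<Rightarrow> real" where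
  "block_process x\<^sub>0 \<omega> 0 = dirac x\<^sub>0"
| "block_process x\<^sub>0 \<omega> (Suc t) = block_avg (snd (\<omega> (Suc t))) (block_process x\<^sub>0 \<omega> t)"

definition d_TV :: "nat \<Rightarrow> nat \<Rightarrow> nat \<Rightarrow> (nat \<Rightarrow> nat \<times> nat set) \<Rightarrow> real" where
  "d_TV n x\<^sub>0 t \<omega> = tv_norm n (\<lambda>x. block_process x\<^sub>0 \<omega> t x - 1 / real n)"

text \<open>Taken in \<open>enat\<close>, so that the infimum of the empty set is \<open>\<infinity>\<close>.\<close>

definition t_mix :: "nat \<Rightarrow> nat pmf \<Rightarrow> nat \<Rightarrow> real \<Rightarrow> enat" where
  "t_mix n p x\<^sub>0 \<epsilon> =
     Inf (enat ` {t. (LINT \<omega>|iid_seq (step_pmf n p). d_TV n x\<^sub>0 t \<omega>) < \<epsilon>})"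

definition size_biased :: "nat pmf \<Rightarrow> nat pmf" where
  "size_biased p =
     embed_pmf (\<lambda>k. real k * pmf p k / measure_pmf.expectation p real)"

definition mean_log_biased :: "nat pmf \<Rightarrow> real" where
  "mean_log_biased p = measure_pmf.expectation (size_biased p) (\<lambda>k. ln (real k))"

definition t_ent :: "nat \<Rightarrow> nat pmf \<Rightarrow> real" where
  "t_ent n p =
     real n * ln (real n) / measure_pmf.expectation p (\<lambda>k. real k * ln (real k))"

text \<open>\<^const>\<open>embed_pmf\<close> is only specified for normalised weights, and the integral in
  \<^const>\<open>t_mix\<close> is only meaningful for a measurable integrand; the following facts show that
  both definitions are used within their range.\<close>

lemma pmf_size_biased:
  assumes "set_pmf p \<subseteq> {2..n}"
  shows "pmf (size_biased p) k = real k * pmf p k / measure_pmf.expectation p real"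
proof -
  have fin: "finite (set_pmf p)"
    using assms finite_subset by blast
  define m where "m = measure_pmf.expectation p real"
  have m: "m = (\<Sum>k\<in>set_pmf p. real k * pmf p k)"
    unfolding m_def by (subst integral_measure_pmf[OF fin]) (auto simp: mult.commute)
  have "(\<Sum>k\<in>set_pmf p. 2 * pmf p k) \<le> m"
    unfolding m using assms by (intro sum_mono mult_right_mono) force+
  then have pos: "m \<ge> 2"
    using sum_pmf_eq_1[OF fin order_refl] by (simp flip: sum_distrib_left)
  have "(\<integral>\<^sup>+ k. ennreal (real k * pmf p k / m) \<partial>count_space UNIV)
      = (\<Sum>k\<in>set_pmf p. ennreal (real k * pmf p k / m))"
    by (rule nn_integral_count_space'[OF fin]) (auto simp: set_pmf_iff)
  also have "\<dots> = ennreal (\<Sum>k\<in>set_pmf p. real k * pmf p k / m)"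
    using pos by (intro sum_ennreal) auto
  also have "(\<Sum>k\<in>set_pmf p. real k * pmf p k / m) = 1"
    using pos by (simp add: m flip: sum_divide_distrib)
  finally show ?thesis
    unfolding size_biased_def m_def[symmetric] using pos by (subst pmf_embed_pmf) auto
qed

lemma mean_log_biased_eq:
  assumes "set_pmf p \<subseteq> {2..n}"
  shows "mean_log_biased p =
    measure_pmf.expectation p (\<lambda>k. real k * ln (real k)) / measure_pmf.expectation p real"
proof -
  have fin: "finite (set_pmf p)"
    using assms finite_subset by blast
  have sub: "k \<in> set_pmf p" if "k \<in> set_pmf (size_biased p)" for k
    using that by (auto simp: set_pmf_iff pmf_size_biased[OF assms])
  have "mean_log_biased p = (\<Sum>k\<in>set_pmf p. ln (real k) * pmf (size_biased p) k)"
    unfolding mean_log_biased_def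
    by (subst integral_measure_pmf[OF fin]) (auto simp: sub mult.commute)
  moreover have "measure_pmf.expectation p (\<lambda>k. real k * ln (real k))
      = (\<Sum>k\<in>set_pmf p. real k * ln (real k) * pmf p k)"
    by (subst integral_measure_pmf[OF fin]) (auto simp: mult.commute)
  ultimately show ?thesis
    by (simp add: pmf_size_biased[OF assms] sum_divide_distrib mult_ac)
qed

lemma measurable_block_process:
  "(\<lambda>\<omega>. block_process x\<^sub>0 \<omega> t x) \<in> borel_measurable (iid_seq p)"
proof (induction t arbitrary: x)
  case 0
  show ?case by simp
next
  case (Suc t)
  define F where "F = (\<lambda>\<omega>::nat \<Rightarrow> nat \<times> nat set.
    if finite (snd (\<omega> (Suc t))) then snd (\<omega> (Suc t)) else {})"
  have pr[measurable]: "(\<lambda>\<omega>. \<omega> (Suc t)) \<in> iid_seq p \<rightarrow>\<^sub>M count_space UNIV"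
    unfolding iid_seq_def by (auto intro: measurable_component_singleton
      simp flip: measurable_cong_sets[OF refl sets_measure_pmf_count_space])
  have [measurable]: "(\<lambda>\<omega>. x \<in> snd (\<omega> (Suc t))) \<in> iid_seq p \<rightarrow>\<^sub>M count_space UNIV"
    by (rule measurable_compose[OF pr]) simp
  have [measurable]: "F \<in> iid_seq p \<rightarrow>\<^sub>M count_space (Collect finite)"
    unfolding F_def by (rule measurable_compose[OF pr]) auto
  have "countable (Collect finite :: nat set set)"
    by (rule countable_Collect_finite)
  then have "(\<lambda>\<omega>. (\<Sum>y\<in>F \<omega>. block_process x\<^sub>0 \<omega> t y) / real (card (F \<omega>)))
      \<in> borel_measurable (iid_seq p)"
    by (intro measurable_compose_countable'[where g = F and I = "Collect finite"
          and f = "\<lambda>A \<omega>. (\<Sum>y\<in>A. block_process x\<^sub>0 \<omega> t y) / real (card A)"])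
       (auto intro!: borel_measurable_divide borel_measurable_sum Suc.IH)
  moreover have "(\<Sum>y\<in>F \<omega>. block_process x\<^sub>0 \<omega> t y) / real (card (F \<omega>))
      = (\<Sum>y\<in>snd (\<omega> (Suc t)). block_process x\<^sub>0 \<omega> t y) / real (card (snd (\<omega> (Suc t))))" for \<omega>
    by (simp add: F_def)
  ultimately have [measurable]: "(\<lambda>\<omega>. (\<Sum>y\<in>snd (\<omega> (Suc t)). block_process x\<^sub>0 \<omega> t y)
      / real (card (snd (\<omega> (Suc t))))) \<in> borel_measurable (iid_seq p)"
    by simp
  note [measurable] = Suc.IH
  show ?case
    unfolding block_process.simps block_avg_def by measurable
qed

lemma measurable_d_TV: "d_TV n x\<^sub>0 t \<in> borel_measurable (iid_seq p)"
proof -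
  note [measurable] = measurable_block_process
  show ?thesis
    unfolding d_TV_def[abs_def] tv_norm_def by measurable
qed

end

theory Submission
  imports Defs "HOL-Real_Asymp.Real_Asymp"
begin

text \<open>
  Follow a particle which jumps to a uniform point of every block containing it. Given the blocks,
  \<open>\<eta>\<^sub>t\<close> is the law of its position, and a typical particle has met about \<open>t E[X] / n\<close> blocks, whose
  sizes are independent copies of \<open>Y\<close>; so the logarithmic weight \<open>L\<^sub>t\<close>, the sum of the logarithms of
  these sizes, concentrates around \<open>ln n \<cdot> t / t\<^sub>e\<^sub>n\<^sub>t\<close>.

  Lower bound: at the position of the particle \<open>\<eta>\<^sub>t \<ge> exp (- L\<^sub>t)\<close>. If \<open>L\<^sub>t\<close> is smaller than \<open>ln n\<close> by a
  factor below 1, almost all the mass sits on \<open>o(n)\<close> points.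

  Upper bound: let \<open>w\<close> be the part of \<open>\<eta>\<^sub>t\<close> carried by particles with \<open>L\<^sub>t \<ge> b = (1 + \<delta> / 2) ln n\<close>.
  Two particles in the same environment that have never separated are together with probability
  \<open>exp (- L\<^sub>t)\<close>, and later encounters contribute at most \<open>1 / (n - 1)\<close>, so
  \<open>E (\<Sum>x. w(x)\<^sup>2) \<le> exp (- b) + 1 / (n - 1)\<close>. As \<open>w\<close> has mass close to 1, it is close to uniform
  in \<open>L\<^sup>2\<close>, with no spectral estimate involved.

  Concentration of \<open>L\<^sub>t\<close> holds in \<open>L\<^sup>1\<close>: the mean absolute deviation of a sum of centred i.i.d.
  variables is monotone and subadditive in the number of summands, so the weak law at the single length
  \<open>\<lfloor>ln n / \<mu>\<rfloor>\<close> controls it at all comparable lengths, random ones included.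
\<close>

section \<open>Finitely supported i.i.d. sequences\<close>

lemma expectation_pmf_swap:
  fixes g :: "'a \<Rightarrow> 'b \<Rightarrow> real"
  assumes "finite (set_pmf p)" "finite (set_pmf q)"
  shows "measure_pmf.expectation p (\<lambda>x. measure_pmf.expectation q (g x)) =
         measure_pmf.expectation q (\<lambda>y. measure_pmf.expectation p (\<lambda>x. g x y))"
proof -
  have p: "measure_pmf.expectation p f = (\<Sum>x\<in>set_pmf p. pmf p x * f x)" for f :: "'a \<Rightarrow> real"
    using integral_measure_pmf[OF assms(1), of p f] by simp
  have q: "measure_pmf.expectation q f = (\<Sum>x\<in>set_pmf q. pmf q x * f x)" for f :: "'b \<Rightarrow> real"
    using integral_measure_pmf[OF assms(2), of q f] by simp
  show ?thesis
    unfolding p q sum_distrib_left by (subst sum.swap) (simp add: mult_ac)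
qed

lemma expectation_pmf_mono:
  fixes f g :: "'a \<Rightarrow> real"
  assumes "finite (set_pmf p)" "\<And>x. x \<in> set_pmf p \<Longrightarrow> f x \<le> g x"
  shows "measure_pmf.expectation p f \<le> measure_pmf.expectation p g"
  using assms
  by (intro integral_mono_AE) (auto simp: integrable_measure_pmf_finite AE_measure_pmf_iff)

lemma expectation_pmf_cong:
  fixes f g :: "'a \<Rightarrow> real"
  assumes "\<And>x. x \<in> set_pmf p \<Longrightarrow> f x = g x"
  shows "measure_pmf.expectation p f = measure_pmf.expectation p g"
  using assms by (intro integral_cong_AE) (auto simp: AE_measure_pmf_iff)

lemma expectation_pmf_abs_le_sqrt:
  fixes f :: "'a \<Rightarrow> real"
  assumes "finite (set_pmf p)"
  shows "measure_pmf.expectation p (\<lambda>x. \<bar>f x\<bar>) \<le> sqrt (measure_pmf.expectation p (\<lambda>x. (f x)\<^sup>2))"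
proof -
  have "(measure_pmf.expectation p (\<lambda>x. \<bar>f x\<bar>))\<^sup>2 \<le> measure_pmf.expectation p (\<lambda>x. (f x)\<^sup>2)"
    using measure_pmf.variance_eq[of p "\<lambda>x. \<bar>f x\<bar>"]
      measure_pmf.variance_positive[of p "\<lambda>x. \<bar>f x\<bar>"]
    by (simp add: integrable_measure_pmf_finite[OF assms])
  then show ?thesis
    by (rule real_le_rsqrt)
qed

section \<open>Initial segments of an i.i.d. sequence\<close>

text \<open>A finitely supported stand-in for \<open>iid_seq\<close>: expectations are finite sums,
  so integrability and interchange of expectations come for free. Coordinates outside
  \<open>{1..t}\<close> keep the arbitrary value \<open>undefined\<close>.\<close>

primrec iid_path :: "'a pmf \<Rightarrow> nat \<Rightarrow> (nat \<Rightarrow> 'a) pmf" where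
  "iid_path p 0 = return_pmf (\<lambda>_. undefined)"
| "iid_path p (Suc t) = bind_pmf (iid_path p t) (\<lambda>\<omega>. map_pmf (\<lambda>z. fun_upd \<omega> (Suc t) z) p)"

lemma finite_set_iid_path: "finite (set_pmf p) \<Longrightarrow> finite (set_pmf (iid_path p t))"
  by (induction t) auto

lemma set_iid_path: "\<omega> \<in> set_pmf (iid_path p t) \<Longrightarrow> s \<in> {1..t} \<Longrightarrow> \<omega> s \<in> set_pmf p"
proof (induction t arbitrary: \<omega>)
  case (Suc t)
  then show ?case by (cases "s = Suc t") auto
qed simp

lemma expectation_iid_path_Suc:
  fixes g :: "(nat \<Rightarrow> 'a) \<Rightarrow> real"
  assumes "finite (set_pmf p)"
  shows "measure_pmf.expectation (iid_path p (Suc t)) g =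
    measure_pmf.expectation (iid_path p t) (\<lambda>\<omega>. measure_pmf.expectation p (\<lambda>z. g (fun_upd \<omega> (Suc t) z)))"
proof -
  note fin = finite_set_iid_path[OF assms, of t]
  show ?thesis
    using assms fin
    by (simp add: pmf_expectation_bind[OF fin] integral_measure_pmf[OF fin])
qed

lemma measurable_fun_upd_iid_seq:
  "(\<lambda>\<omega>. fun_upd \<omega> i z) \<in> iid_seq p \<rightarrow>\<^sub>M iid_seq p"
  unfolding iid_seq_def
  by (rule measurable_fun_upd[where J = UNIV]) auto

text \<open>Replacing one coordinate by an independent draw from \<open>p\<close> preserves the
  product measure; Fubini then isolates that coordinate.\<close>

lemma integral_iid_seq_fun_upd:
  fixes F :: "(nat \<Rightarrow> 'a) \<Rightarrow> real"
  assumes "finite (set_pmf p)"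
    and meas: "F \<in> borel_measurable (iid_seq p)"
    and bd: "\<And>\<omega>. \<bar>F \<omega>\<bar> \<le> B"
  shows "(LINT \<omega>|iid_seq p. F \<omega>) =
    measure_pmf.expectation p (\<lambda>z. LINT \<omega>|iid_seq p. F (fun_upd \<omega> i z))"
proof -
  let ?M = "iid_seq p"
  have ps: "prob_space ?M"
    unfolding iid_seq_def by (intro prob_space_PiM measure_pmf.prob_space_axioms)
  interpret M: prob_space ?M by (rule ps)
  interpret P: pair_prob_space "measure_pmf p" ?M ..
  have eq: "distr (measure_pmf p \<Otimes>\<^sub>M ?M) ?M (\<lambda>(x, X). X(i := x)) = ?M"
    using distr_pair_PiM_eq_PiM[of UNIV "\<lambda>_. measure_pmf p" i]
    by (simp add: iid_seq_def measure_pmf.prob_space_axioms)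
  have upd: "(\<lambda>(x, X). X(i := x)) \<in> measure_pmf p \<Otimes>\<^sub>M ?M \<rightarrow>\<^sub>M ?M"
    unfolding iid_seq_def case_prod_beta
    by (rule measurable_fun_upd[where J = UNIV]) auto
  have "(LINT \<omega>|?M. F \<omega>) = (LINT \<omega>|(distr (measure_pmf p \<Otimes>\<^sub>M ?M) ?M (\<lambda>(x, X). X(i := x))). F \<omega>)"
    by (simp add: eq)
  also have "\<dots> = (LINT y|(measure_pmf p \<Otimes>\<^sub>M ?M). F ((\<lambda>(x, X). X(i := x)) y))"
    by (rule integral_distr[OF upd meas])
  also have "\<dots> = (LINT x|p. LINT X|?M. F (X(i := x)))"
  proof -
    have "integrable (measure_pmf p \<Otimes>\<^sub>M ?M) (\<lambda>y. F ((\<lambda>(x, X). X(i := x)) y))"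
      using bd by (intro P.integrable_const_bound[where B = B]
        measurable_compose[OF upd meas]) auto
    then show ?thesis
      using P.integral_fst[of "\<lambda>x X. F (X(i := x))"] by (simp add: case_prod_beta')
  qed
  finally show ?thesis .
qed

text \<open>Bridge from the infinite product space to finite paths. In the induction the last
  coordinate is resampled; once it is frozen, the integrand depends only on the earlier
  ones.\<close>

lemma integral_iid_seq:
  fixes F :: "(nat \<Rightarrow> 'a) \<Rightarrow> real"
  assumes fin: "finite (set_pmf p)"
    and "F \<in> borel_measurable (iid_seq p)"
    and "\<And>\<omega>. \<bar>F \<omega>\<bar> \<le> B"
    and "\<And>\<omega> \<omega>'. (\<And>s. s \<in> {1..t} \<Longrightarrow> \<omega> s = \<omega>' s) \<Longrightarrow> F \<omega> = F \<omega>'"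
  shows "(LINT \<omega>|iid_seq p. F \<omega>) = measure_pmf.expectation (iid_path p t) F"
  using assms(2-)
proof (induction t arbitrary: F)
  case 0
  have ps: "prob_space (iid_seq p)"
    unfolding iid_seq_def by (intro prob_space_PiM measure_pmf.prob_space_axioms)
  have "F = (\<lambda>_. F (\<lambda>_. undefined))"
    using 0(3) by fastforce
  then obtain c where "F = (\<lambda>_. c)"
    by blast
  then show ?case
    by (simp add: prob_space.prob_space[OF ps])
next
  case (Suc t)
  have "(LINT \<omega>|iid_seq p. F \<omega>) =
      measure_pmf.expectation p (\<lambda>z. LINT \<omega>|iid_seq p. F (fun_upd \<omega> (Suc t) z))"
    by (rule integral_iid_seq_fun_upd[OF fin Suc.prems(1,2)])
  also have "\<dots> = measure_pmf.expectation p
      (\<lambda>z. measure_pmf.expectation (iid_path p t) (\<lambda>\<omega>. F (fun_upd \<omega> (Suc t) z)))"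
  proof (intro expectation_pmf_cong Suc.IH)
    show "(\<lambda>\<omega>. F (fun_upd \<omega> (Suc t) z)) \<in> borel_measurable (iid_seq p)" for z
      by (rule measurable_compose[OF measurable_fun_upd_iid_seq Suc.prems(1)])
    show "F (fun_upd \<omega> (Suc t) z) = F (fun_upd \<omega>' (Suc t) z)"
      if "\<And>s. s \<in> {1..t} \<Longrightarrow> \<omega> s = \<omega>' s" for z \<omega> \<omega>'
      using that by (intro Suc.prems(3)) auto
  qed (rule Suc.prems(2))
  also have "\<dots> = measure_pmf.expectation (iid_path p (Suc t)) F"
    by (simp only: expectation_iid_path_Suc[OF fin]
        expectation_pmf_swap[OF fin finite_set_iid_path[OF fin]])
  finally show ?case .
qed

text \<open>A random walk started at \<open>a\<close> is described by powers of its one-step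
  transition operator. Later arguments compare such powers instead of joint laws.\<close>

lemma expectation_iid_path_sum:
  fixes g :: "real \<Rightarrow> real" and Z :: "'a \<Rightarrow> real"
  assumes "finite (set_pmf p)"
  shows "measure_pmf.expectation (iid_path p t) (\<lambda>\<omega>. g (a + (\<Sum>s\<in>{1..t}. Z (\<omega> s)))) =
    ((\<lambda>g a. measure_pmf.expectation p (\<lambda>z. g (a + Z z))) ^^ t) g a"
proof (induction t arbitrary: g)
  case (Suc t)
  have "(\<Sum>s\<in>{1..Suc t}. Z (fun_upd \<omega> (Suc t) z s)) = (\<Sum>s\<in>{1..t}. Z (\<omega> s)) + Z z" for \<omega> z
    by (simp add: sum.cl_ivl_Suc)
  then show ?case
    unfolding expectation_iid_path_Suc[OF assms] funpow_Suc_right o_apply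
    by (subst Suc.IH[symmetric]) (simp add: add_ac)
qed simp

section \<open>Mean absolute deviation of sums of centred variables\<close>

locale centered_pmf =
  fixes p :: "'a pmf" and Z :: "'a \<Rightarrow> real"
  assumes fin: "finite (set_pmf p)" and mean0: "measure_pmf.expectation p Z = 0"
begin

lemma integrable_iid_path: "integrable (measure_pmf (iid_path p t)) (f :: _ \<Rightarrow> real)"
  by (rule integrable_measure_pmf_finite[OF finite_set_iid_path[OF fin]])

lemma integrable_pmf: "integrable (measure_pmf p) (f :: _ \<Rightarrow> real)"
  by (rule integrable_measure_pmf_finite[OF fin])

definition abs_dev :: "nat \<Rightarrow> real" where
  "abs_dev t = measure_pmf.expectation (iid_path p t) (\<lambda>\<omega>. \<bar>\<Sum>s\<in>{1..t}. Z (\<omega> s)\<bar>)"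

lemma sum_upd: "(\<Sum>s\<in>{1..Suc t}. Z (fun_upd \<omega> (Suc t) z s)) = (\<Sum>s\<in>{1..t}. Z (\<omega> s)) + Z z"
  by (simp add: sum.cl_ivl_Suc)

lemma expectation_sum_iid_path: "measure_pmf.expectation (iid_path p t) (\<lambda>\<omega>. \<Sum>s\<in>{1..t}. Z (\<omega> s)) = 0"
proof (induction t)
  case (Suc t)
  then show ?case
    unfolding expectation_iid_path_Suc[OF fin] sum_upd
    by (subst Bochner_Integration.integral_add) (simp_all add: integrable_pmf mean0)
qed simp

lemma expectation_sum_iid_path_sq:
  "measure_pmf.expectation (iid_path p t) (\<lambda>\<omega>. (\<Sum>s\<in>{1..t}. Z (\<omega> s))\<^sup>2) =
   t * measure_pmf.expectation p (\<lambda>z. (Z z)\<^sup>2)"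
proof (induction t)
  case (Suc t)
  have "measure_pmf.expectation p (\<lambda>z. (a + Z z)\<^sup>2) = a\<^sup>2 + measure_pmf.expectation p (\<lambda>z. (Z z)\<^sup>2)" for a
  proof -
    have "measure_pmf.expectation p (\<lambda>z. (a + Z z)\<^sup>2) =
       measure_pmf.expectation p (\<lambda>z. a\<^sup>2 + (2 * a) * Z z + (Z z)\<^sup>2)"
      by (simp add: power2_sum algebra_simps)
    also have "\<dots> = a\<^sup>2 + 2 * a * measure_pmf.expectation p Z + measure_pmf.expectation p (\<lambda>z. (Z z)\<^sup>2)"
      by (simp add: integrable_pmf)
    finally show ?thesis by (simp add: mean0)
  qed
  then show ?case
    unfolding expectation_iid_path_Suc[OF fin] sum_upd
    by (simp only: Bochner_Integration.integral_add integrable_iid_path Suc.IH)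
      (simp add: algebra_simps)
qed simp

text \<open>Jensen's inequality, conditionally on the earlier summands: adding a centred term cannot
  decrease the mean modulus.\<close>

lemma abs_dev_mono: "i \<le> j \<Longrightarrow> abs_dev i \<le> abs_dev j"
proof (induction j rule: dec_induct)
  case (step t)
  have "\<bar>a\<bar> \<le> measure_pmf.expectation p (\<lambda>z. \<bar>a + Z z\<bar>)" for a
    using integral_abs_bound[of "measure_pmf p" "\<lambda>z. a + Z z"] by (simp add: integrable_pmf mean0)
  then have "abs_dev t \<le> abs_dev (Suc t)"
    unfolding abs_dev_def expectation_iid_path_Suc[OF fin] sum_upd
    by (intro expectation_pmf_mono finite_set_iid_path fin)
  with step show ?case by simp
qed simp

text \<open>The semigroup property cuts the walk after \<open>i\<close> steps; from a position
  \<open>a\<close>, the remaining \<open>j\<close> steps end at mean modulus at most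
  \<open>\<bar>a\<bar> + abs_dev j\<close>.\<close>

lemma abs_dev_add: "abs_dev (i + j) \<le> abs_dev i + abs_dev j"
proof -
  let ?T = "\<lambda>g a. measure_pmf.expectation p (\<lambda>z. g (a + Z z))"
  have eq: "(?T ^^ t) g a = measure_pmf.expectation (iid_path p t) (\<lambda>\<omega>. g (a + (\<Sum>s\<in>{1..t}. Z (\<omega> s))))"
    for t a and g :: "real \<Rightarrow> real"
    by (rule expectation_iid_path_sum[OF fin, symmetric])
  have *: "(?T ^^ j) abs a \<le> \<bar>a\<bar> + abs_dev j" for a
  proof -
    have "(?T ^^ j) abs a \<le> measure_pmf.expectation (iid_path p j)
        (\<lambda>\<omega>. \<bar>a\<bar> + \<bar>\<Sum>s\<in>{1..j}. Z (\<omega> s)\<bar>)"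
      unfolding eq by (intro expectation_pmf_mono finite_set_iid_path fin) auto
    then show ?thesis
      by (simp add: abs_dev_def integrable_iid_path)
  qed
  have "abs_dev (i + j) = (?T ^^ (i + j)) abs 0"
    by (simp add: abs_dev_def eq)
  also have "\<dots> = (?T ^^ i) ((?T ^^ j) abs) 0"
    by (simp add: funpow_add)
  also have "\<dots> \<le> measure_pmf.expectation (iid_path p i)
      (\<lambda>\<omega>. \<bar>\<Sum>s\<in>{1..i}. Z (\<omega> s)\<bar> + abs_dev j)"
    unfolding eq[of i "(?T ^^ j) abs" 0, unfolded add_0]
    by (intro expectation_pmf_mono finite_set_iid_path fin *)
  also have "\<dots> = abs_dev i + abs_dev j"
    by (simp add: integrable_iid_path abs_dev_def)
  finally show ?thesis .
qed

lemma abs_dev_nonneg: "abs_dev i \<ge> 0"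
  unfolding abs_dev_def by (intro Bochner_Integration.integral_nonneg) auto

text \<open>Round \<open>j\<close> up to a multiple of \<open>K\<close>: monotonicity pays for the
  rounding, subadditivity for the multiple.\<close>

lemma abs_dev_le:
  assumes "K > 0"
  shows "abs_dev j \<le> (real j / real K + 1) * abs_dev K"
proof -
  have mult: "abs_dev (m * K) \<le> real m * abs_dev K" for m
  proof (induction m)
    case 0
    then show ?case by (simp add: abs_dev_def)
  next
    case (Suc m)
    then show ?case
      using abs_dev_add[of K "m * K"] by (simp add: algebra_simps)
  qed
  have "j \<le> Suc (j div K) * K"
    using assms by (metis dividend_less_times_div less_imp_le mult.commute mult_Suc_right)
  then have "abs_dev j \<le> abs_dev (Suc (j div K) * K)"
    by (rule abs_dev_mono)
  also have "\<dots> \<le> real (Suc (j div K)) * abs_dev K"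
    by (rule mult)
  also have "\<dots> \<le> (real j / real K + 1) * abs_dev K"
    using of_nat_div_le_of_nat[of j K] by (intro mult_right_mono abs_dev_nonneg) simp
  finally show ?thesis .
qed

end

section \<open>Uniformly random blocks\<close>

lemma card_subsets_containing:
  assumes "finite V" "B \<subseteq> V" "card B \<le> k"
  shows "card {A. A \<subseteq> V \<and> card A = k \<and> B \<subseteq> A} = (card V - card B) choose (k - card B)"
proof -
  have fB: "finite B" using assms finite_subset by blast
  have "bij_betw (\<lambda>C. C \<union> B) {C. C \<subseteq> V - B \<and> card C = k - card B}
     {A. A \<subseteq> V \<and> card A = k \<and> B \<subseteq> A}"
  proof (rule bij_betw_byWitness[where f' = "\<lambda>A. A - B"])
    show "(\<lambda>C. C \<union> B) ` {C. C \<subseteq> V - B \<and> card C = k - card B} \<subseteq> {A. A \<subseteq> V \<and> card A = k \<and> B \<subseteq> A}"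
    proof clarsimp
      fix C assume C: "C \<subseteq> V - B" "card C = k - card B"
      then have "finite C" "C \<inter> B = {}"
        using assms(1) finite_subset by blast+
      then show "C \<subseteq> V \<and> B \<subseteq> V \<and> card (C \<union> B) = k"
        using C assms fB by (auto simp: card_Un_disjoint)
    qed
    show "(\<lambda>A. A - B) ` {A. A \<subseteq> V \<and> card A = k \<and> B \<subseteq> A} \<subseteq> {C. C \<subseteq> V - B \<and> card C = k - card B}"
      using fB by (auto simp: card_Diff_subset)
  qed blast+
  then have "card {A. A \<subseteq> V \<and> card A = k \<and> B \<subseteq> A} = card {C. C \<subseteq> V - B \<and> card C = k - card B}"
    by (rule bij_betw_same_card[symmetric])
  then show ?thesis
    using assms fB by (simp add: n_subsets card_Diff_subset)
qed

lemma sum_subsets_sum: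
  fixes h :: "'a \<Rightarrow> real"
  assumes V: "finite V" and k: "1 \<le> k"
  shows "(\<Sum>A | A \<subseteq> V \<and> card A = k. \<Sum>x\<in>A. h x) = real ((card V - 1) choose (k - 1)) * (\<Sum>x\<in>V. h x)"
proof -
  let ?S = "{A. A \<subseteq> V \<and> card A = k}"
  have fin: "finite ?S" using V by simp
  have "(\<Sum>A\<in>?S. \<Sum>x\<in>A. h x) = (\<Sum>A\<in>?S. \<Sum>x\<in>V. if x \<in> A then h x else 0)"
  proof (rule sum.cong[OF refl])
    fix A assume "A \<in> ?S"
    then have "V \<inter> A = A" by auto
    then show "(\<Sum>x\<in>A. h x) = (\<Sum>x\<in>V. if x \<in> A then h x else 0)"
      using V by (simp flip: sum.inter_restrict)
  qed
  also have "\<dots> = (\<Sum>x\<in>V. \<Sum>A\<in>?S. if x \<in> A then h x else 0)"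
    by (rule sum.swap)
  also have "\<dots> = (\<Sum>x\<in>V. real ((card V - 1) choose (k - 1)) * h x)"
  proof (intro sum.cong refl)
    fix x assume "x \<in> V"
    then have "card {A \<in> ?S. x \<in> A} = (card V - 1) choose (k - 1)"
      using card_subsets_containing[of V "{x}" k] V k by (simp add: conj_ac)
    then show "(\<Sum>A\<in>?S. if x \<in> A then h x else 0) = real ((card V - 1) choose (k - 1)) * h x"
      using fin by (simp add: sum.If_cases Int_def)
  qed
  finally show ?thesis by (simp add: sum_distrib_left)
qed

text \<open>Expand the square into ordered pairs and count the blocks containing each pair; diagonal
  and off-diagonal pairs have different counts.\<close>

lemma sum_subsets_sum_sq:
  fixes h :: "'a \<Rightarrow> real"
  assumes V: "finite V" and k: "2 \<le> k"
  shows "(\<Sum>A | A \<subseteq> V \<and> card A = k. (\<Sum>x\<in>A. h x)\<^sup>2) =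
    real ((card V - 1) choose (k - 1)) * (\<Sum>x\<in>V. (h x)\<^sup>2) +
    real ((card V - 2) choose (k - 2)) * ((\<Sum>x\<in>V. h x)\<^sup>2 - (\<Sum>x\<in>V. (h x)\<^sup>2))"
proof -
  let ?S = "{A. A \<subseteq> V \<and> card A = k}"
  let ?c1 = "real ((card V - 1) choose (k - 1))" and ?c2 = "real ((card V - 2) choose (k - 2))"
  have fin: "finite ?S" using V by simp
  have sq: "(\<Sum>x\<in>B. h x)\<^sup>2 = (\<Sum>(x, y)\<in>B \<times> B. h x * h y)" for B
    by (simp add: power2_eq_square sum_product sum.cartesian_product)
  have "(\<Sum>A\<in>?S. (\<Sum>x\<in>A. h x)\<^sup>2) =
      (\<Sum>A\<in>?S. \<Sum>z\<in>V \<times> V. if z \<in> A \<times> A then h (fst z) * h (snd z) else 0)"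
  proof (intro sum.cong refl)
    fix A assume "A \<in> ?S"
    then have "(V \<times> V) \<inter> (A \<times> A) = A \<times> A" by auto
    then show "(\<Sum>x\<in>A. h x)\<^sup>2 = (\<Sum>z\<in>V \<times> V. if z \<in> A \<times> A then h (fst z) * h (snd z) else 0)"
      using V by (simp add: sq case_prod_beta flip: sum.inter_restrict)
  qed
  also have "\<dots> = (\<Sum>z\<in>V \<times> V. \<Sum>A\<in>?S. if z \<in> A \<times> A then h (fst z) * h (snd z) else 0)"
    by (rule sum.swap)
  also have "\<dots> = (\<Sum>z\<in>V \<times> V. (if fst z = snd z then ?c1 else ?c2) * (h (fst z) * h (snd z)))"
  proof (intro sum.cong refl)
    fix z assume "z \<in> V \<times> V"
    then obtain x y where z: "z = (x, y)" and xy: "x \<in> V" "y \<in> V" by blast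
    have "{A \<in> ?S. z \<in> A \<times> A} = {A. A \<subseteq> V \<and> card A = k \<and> {x, y} \<subseteq> A}"
      using z by auto
    then have "card {A \<in> ?S. z \<in> A \<times> A} = (card V - card {x, y}) choose (k - card {x, y})"
      using card_subsets_containing[of V "{x, y}" k] V k xy by (simp add: card_insert_if)
    then have "real (card {A \<in> ?S. z \<in> A \<times> A}) = (if x = y then ?c1 else ?c2)"
      by (simp add: numeral_2_eq_2)
    then show "(\<Sum>A\<in>?S. if z \<in> A \<times> A then h (fst z) * h (snd z) else 0) =
        (if fst z = snd z then ?c1 else ?c2) * (h (fst z) * h (snd z))"
      using fin z by (simp add: sum.If_cases Int_def)
  qed
  \<comment> \<open>All pairs get the off-diagonal count, with a correction on the diagonal, so that
    the full double sum factorises into a square.\<close>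
  also have "\<dots> = (\<Sum>z\<in>V \<times> V. ?c2 * (h (fst z) * h (snd z)) +
      (if fst z = snd z then (?c1 - ?c2) * (h (fst z) * h (snd z)) else 0))"
    by (intro sum.cong refl) (auto simp: algebra_simps)
  also have "\<dots> = ?c2 * (\<Sum>z\<in>V \<times> V. h (fst z) * h (snd z)) +
      (\<Sum>z\<in>V \<times> V. if fst z = snd z then (?c1 - ?c2) * (h (fst z) * h (snd z)) else 0)"
    by (simp add: sum.distrib sum_distrib_left)
  also have "(\<Sum>z\<in>V \<times> V. if fst z = snd z then (?c1 - ?c2) * (h (fst z) * h (snd z)) else 0) =
      (\<Sum>x\<in>V. \<Sum>y\<in>V. if x = y then (?c1 - ?c2) * (h x * h y) else 0)"
    by (simp add: sum.cartesian_product case_prod_beta)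
  also have "\<dots> = (?c1 - ?c2) * (\<Sum>x\<in>V. (h x)\<^sup>2)"
    using V by (simp add: sum_distrib_left power2_eq_square)
  finally show ?thesis
    by (simp add: sq case_prod_beta algebra_simps)
qed

lemma binomial_ratio_1:
  assumes "1 \<le> k" "k \<le> n"
  shows "real ((n - 1) choose (k - 1)) / real (n choose k) = real k / real n"
proof -
  have "k * (n choose k) = n * ((n - 1) choose (k - 1))"
    using assms times_binomial_minus1_eq[of k n] by simp
  then have "real k * real (n choose k) = real n * real ((n - 1) choose (k - 1))"
    by (metis of_nat_mult)
  moreover have "n choose k > 0" using assms by simp
  ultimately show ?thesis
    using assms by (simp add: field_simps)
qed

text \<open>The probability that a uniform block contains two given distinct points, as a product of
  two one-point ratios.\<close>

lemma binomial_ratio_2: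
  assumes "2 \<le> k" "k \<le> n"
  shows "real ((n - 2) choose (k - 2)) / real (n choose k) =
    real k * (real k - 1) / (real n * (real n - 1))"
proof -
  have "real ((n - 1 - 1) choose (k - 1 - 1)) / real ((n - 1) choose (k - 1)) = real (k - 1) / real (n - 1)"
    using assms by (intro binomial_ratio_1) auto
  then have 1: "real ((n - 2) choose (k - 2)) / real ((n - 1) choose (k - 1)) = (real k - 1) / (real n - 1)"
    using assms by (simp add: of_nat_diff numeral_2_eq_2)
  have 2: "real ((n - 1) choose (k - 1)) / real (n choose k) = real k / real n"
    using assms by (intro binomial_ratio_1) auto
  have "real ((n - 2) choose (k - 2)) / real (n choose k) =
      real ((n - 2) choose (k - 2)) / real ((n - 1) choose (k - 1)) *
      (real ((n - 1) choose (k - 1)) / real (n choose k))"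
    using assms by simp
  also have "\<dots> = real k * (real k - 1) / (real n * (real n - 1))"
    by (simp only: 1 2) (simp add: mult_ac)
  finally show ?thesis .
qed

text \<open>The mass at \<open>x\<close>, each unit of mass being weighted by \<open>f a\<close>, where \<open>a\<close> is the sum of the
  logarithms of the sizes of the blocks in which this unit has been averaged up to time \<open>t\<close>.\<close>

primrec weighted_mass ::
  "nat \<Rightarrow> (nat \<Rightarrow> nat \<times> nat set) \<Rightarrow> nat \<Rightarrow> (real \<Rightarrow> real) \<Rightarrow> nat \<Rightarrow> real" where
  "weighted_mass x\<^sub>0 \<omega> 0 f x = dirac x\<^sub>0 x * f 0"
| "weighted_mass x\<^sub>0 \<omega> (Suc t) f x = (let A = snd (\<omega> (Suc t)) in
     if x \<in> A then (\<Sum>y\<in>A. weighted_mass x\<^sub>0 \<omega> t (\<lambda>a. f (a + ln (real (card A)))) y) / real (card A)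
     else weighted_mass x\<^sub>0 \<omega> t f x)"

section \<open>The weighted mass for a fixed sequence of blocks\<close>

text \<open>Through this identity, positivity, conservation of mass and dependence on the first
  \<open>t\<close> blocks are inherited by the process from \<open>weighted_mass\<close>.\<close>

lemma weighted_mass_1: "weighted_mass x\<^sub>0 \<omega> t (\<lambda>_. 1) x = block_process x\<^sub>0 \<omega> t x"
  by (induction t arbitrary: x) (simp_all add: block_avg_def Let_def)

lemma weighted_mass_mono:
  "(\<And>a. f a \<le> g a) \<Longrightarrow> weighted_mass x\<^sub>0 \<omega> t f x \<le> weighted_mass x\<^sub>0 \<omega> t g x"
proof (induction t arbitrary: f g x)
  case 0
  then show ?case by (simp add: dirac_def)
next
  case (Suc t)
  then show ?case
    by (auto simp: Let_def intro!: divide_right_mono sum_mono Suc.IH)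
qed

lemma weighted_mass_0: "weighted_mass x\<^sub>0 \<omega> t (\<lambda>_. 0) x = 0"
  by (induction t arbitrary: x) (simp_all add: Let_def)

lemma weighted_mass_nonneg: "(\<And>a. 0 \<le> f a) \<Longrightarrow> 0 \<le> weighted_mass x\<^sub>0 \<omega> t f x"
  using weighted_mass_mono[of "\<lambda>_. 0" f] by (simp add: weighted_mass_0)

lemma weighted_mass_le_block_process:
  "(\<And>a. f a \<le> 1) \<Longrightarrow> weighted_mass x\<^sub>0 \<omega> t f x \<le> block_process x\<^sub>0 \<omega> t x"
  using weighted_mass_mono[of f "\<lambda>_. 1"] by (simp add: weighted_mass_1)

lemma block_process_nonneg: "0 \<le> block_process x\<^sub>0 \<omega> t x"
  using weighted_mass_nonneg[of "\<lambda>_. 1"] by (simp add: weighted_mass_1)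

lemma block_process_le_1: "block_process x\<^sub>0 \<omega> t x \<le> 1"
proof (induction t arbitrary: x)
  case (Suc t)
  have "(\<Sum>y\<in>A. block_process x\<^sub>0 \<omega> t y) / real (card A) \<le> 1" for A
    using sum_bounded_above[of A "block_process x\<^sub>0 \<omega> t" 1] Suc.IH
    by (cases "card A = 0") (auto simp: divide_le_eq)
  with Suc show ?case
    by (simp add: block_avg_def)
qed (simp add: dirac_def)

lemma weighted_mass_cong:
  "(\<And>s. s \<in> {1..t} \<Longrightarrow> \<omega> s = \<omega>' s) \<Longrightarrow> weighted_mass x\<^sub>0 \<omega> t f x = weighted_mass x\<^sub>0 \<omega>' t f x"
proof (induction t arbitrary: f x)
  case (Suc t)
  have "weighted_mass x\<^sub>0 \<omega> t f = weighted_mass x\<^sub>0 \<omega>' t f" for f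
    by (intro ext Suc.IH Suc.prems) auto
  with Suc.prems[of "Suc t"] show ?case by (simp add: Let_def)
qed simp

lemma weighted_mass_fun_upd [simp]:
  "weighted_mass x\<^sub>0 (fun_upd \<omega> (Suc t) z) t f x = weighted_mass x\<^sub>0 \<omega> t f x"
  by (rule weighted_mass_cong) auto

text \<open>On the block the old values \<open>h\<close> are erased, and the values
  \<open>g\<close>, whose weight has already been shifted by the new logarithm, are spread evenly
  over its \<open>card A\<close> points.\<close>

lemma
  fixes f :: "real \<Rightarrow> real" and x\<^sub>0 :: nat and \<omega> :: "nat \<Rightarrow> nat \<times> nat set"
  assumes "snd (\<omega> (Suc t)) = A" "A \<subseteq> {1..n}" "A \<noteq> {}"
  defines "h \<equiv> weighted_mass x\<^sub>0 \<omega> t f"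
    and "g \<equiv> weighted_mass x\<^sub>0 \<omega> t (\<lambda>a. f (a + ln (real (card A))))"
  shows sum_weighted_mass_Suc: "(\<Sum>x\<in>{1..n}. weighted_mass x\<^sub>0 \<omega> (Suc t) f x) =
      (\<Sum>x\<in>{1..n}. h x) - (\<Sum>x\<in>A. h x) + (\<Sum>x\<in>A. g x)" (is ?th1)
    and sum_weighted_mass_sq_Suc: "(\<Sum>x\<in>{1..n}. (weighted_mass x\<^sub>0 \<omega> (Suc t) f x)\<^sup>2) =
      (\<Sum>x\<in>{1..n}. (h x)\<^sup>2) - (\<Sum>x\<in>A. (h x)\<^sup>2) + (\<Sum>x\<in>A. g x)\<^sup>2 / real (card A)" (is ?th2)
proof -
  have fin: "finite A" using assms finite_subset by blast
  have c: "card A > 0" using assms fin by auto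
  have split: "(\<Sum>x\<in>{1..n}. F x) = (\<Sum>x\<in>{1..n} - A. F x) + (\<Sum>x\<in>A. F x)" for F :: "nat \<Rightarrow> real"
    using assms by (simp add: sum.subset_diff)
  have w: "weighted_mass x\<^sub>0 \<omega> (Suc t) f x = (if x \<in> A then (\<Sum>y\<in>A. g y) / real (card A) else h x)" for x
    using assms by (simp add: Let_def)
  have in_A: "(\<Sum>x\<in>{1..n} - A. if x \<in> A then b x else F x) = (\<Sum>x\<in>{1..n} - A. F x)"
    "(\<Sum>x\<in>A. if x \<in> A then b x else F x) = (\<Sum>x\<in>A. b x)" for b F :: "nat \<Rightarrow> real"
    by (auto intro: sum.cong)
  show ?th1
    unfolding w split[of h] by (subst split, unfold in_A) (use c in simp)
  show ?th2
    unfolding w if_distrib[of "\<lambda>x. x\<^sup>2"] split[of "\<lambda>x. (h x)\<^sup>2"]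
    by (subst split, unfold in_A) (use c in \<open>simp add: power2_eq_square\<close>)
qed

text \<open>The sums of \<open>v\<close> over \<open>B\<close> and of \<open>-v\<close> over the
  complement agree, so twice either one is bounded by the sum of all the moduli.\<close>

lemma sum_subset_le_tv_norm:
  assumes "B \<subseteq> {1..n}" "(\<Sum>x\<in>{1..n}. v x) = 0"
  shows "(\<Sum>x\<in>B. v x) \<le> tv_norm n v"
proof -
  have split: "(\<Sum>x\<in>{1..n}. F x) = (\<Sum>x\<in>{1..n} - B. F x) + (\<Sum>x\<in>B. F x)" for F :: "nat \<Rightarrow> real"
    using assms by (simp add: sum.subset_diff)
  have "(\<Sum>x\<in>B. v x) \<le> (\<Sum>x\<in>B. \<bar>v x\<bar>)" "(\<Sum>x\<in>{1..n} - B. - v x) \<le> (\<Sum>x\<in>{1..n} - B. \<bar>v x\<bar>)"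
    by (intro sum_mono; simp)+
  then show ?thesis
    using assms(2) unfolding tv_norm_def split[of v] split[of "\<lambda>x. \<bar>v x\<bar>"] sum_negf by simp
qed

text \<open>A block of size \<open>k\<close> divides the mass of a particle inside it by at most \<open>k\<close>.\<close>

lemma weighted_mass_atMost_eq_0:
  assumes "\<And>s. s \<in> {1..t} \<Longrightarrow> finite (snd (\<omega> s)) \<and> snd (\<omega> s) \<noteq> {}"
    and "block_process x\<^sub>0 \<omega> t x < exp (- b)"
  shows "weighted_mass x\<^sub>0 \<omega> t (\<lambda>a. if a \<le> b then 1 else 0) x = 0"
  using assms
proof (induction t arbitrary: b x)
  case 0
  then show ?case by (auto simp: dirac_def split: if_splits)
next
  case (Suc t)
  define A where "A = snd (\<omega> (Suc t))"
  have A: "finite A" "A \<noteq> {}" using Suc.prems(1)[of "Suc t"] by (auto simp: A_def)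
  then have k: "real (card A) > 0" by (simp add: card_gt_0_iff)
  have IH: "weighted_mass x\<^sub>0 \<omega> t (\<lambda>a. if a \<le> b then 1 else 0) y = 0"
    if "block_process x\<^sub>0 \<omega> t y < exp (- b)" for b y
    using that by (intro Suc.IH Suc.prems) auto
  show ?case
  proof (cases "x \<in> A")
    case True
    \<comment> \<open>The induction hypothesis is applied with the threshold lowered by
      \<open>ln (card A)\<close>: before averaging, each point of \<open>A\<close> had at most
      \<open>card A\<close> times the averaged mass.\<close>
    have "weighted_mass x\<^sub>0 \<omega> t (\<lambda>a. if a + ln (real (card A)) \<le> b then 1 else 0) y = 0" if "y \<in> A" for y
    proof -
      have "(\<Sum>y\<in>A. block_process x\<^sub>0 \<omega> t y) / real (card A) < exp (- b)"
        using Suc.prems(2) True by (simp add: block_avg_def A_def)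
      moreover have "block_process x\<^sub>0 \<omega> t y \<le> (\<Sum>y\<in>A. block_process x\<^sub>0 \<omega> t y)"
        using A that by (intro member_le_sum block_process_nonneg) auto
      ultimately have "block_process x\<^sub>0 \<omega> t y < exp (- b) * real (card A)"
        using k by (simp add: divide_less_eq)
      also have "\<dots> = exp (- (b - ln (real (card A))))"
        using k by (simp add: exp_diff exp_minus field_simps)
      finally have "block_process x\<^sub>0 \<omega> t y < exp (- (b - ln (real (card A))))" .
      from IH[OF this] show ?thesis by (simp add: le_diff_eq)
    qed
    then show ?thesis
      using True by (simp add: Let_def flip: A_def)
  next
    case False
    then show ?thesis
      using IH Suc.prems(2) by (simp add: block_avg_def Let_def flip: A_def)
  qed
qed

section \<open>The block average process\<close>

locale block_average =
  fixes n :: nat and p :: "nat pmf" and x\<^sub>0 :: nat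
  assumes p: "set_pmf p \<subseteq> {2..n}" and n: "n \<ge> 2" and x0: "x\<^sub>0 \<in> {1..n}"
begin

lemma finite_set_p: "finite (set_pmf p)"
  using p finite_subset by blast

lemma integrable_p: "integrable (measure_pmf p) (f :: _ \<Rightarrow> real)"
  by (rule integrable_measure_pmf_finite[OF finite_set_p])

lemma blocks_nonempty:
  assumes "k \<le> n"
  shows "finite {A. A \<subseteq> {1..n} \<and> card A = k} \<and> {A. A \<subseteq> {1..n} \<and> card A = k} \<noteq> {}"
proof -
  have "card {A. A \<subseteq> {1..n} \<and> card A = k} > 0"
    using assms by (subst n_subsets) auto
  then show ?thesis
    by (subst (asm) card_gt_0_iff) blast
qed

lemma set_step_pmf:
  assumes "z \<in> set_pmf (step_pmf n p)"
  shows "snd z \<subseteq> {1..n}" "card (snd z) \<in> {2..n}" "fst z = card (snd z)" "snd z \<noteq> {}"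
proof -
  obtain k A where k: "k \<in> set_pmf p" and z: "z = (k, A)"
    and A: "A \<in> set_pmf (pmf_of_set {A. A \<subseteq> {1..n} \<and> card A = k})"
    using assms by (auto simp: step_pmf_def)
  have "k \<in> {2..n}" using k p by blast
  then have "A \<subseteq> {1..n}" "card A = k"
    using A blocks_nonempty[of k] by (simp_all add: set_pmf_of_set)
  then show "snd z \<subseteq> {1..n}" "card (snd z) \<in> {2..n}" "fst z = card (snd z)" "snd z \<noteq> {}"
    using \<open>k \<in> {2..n}\<close> z by auto
qed

lemma finite_set_step: "finite (set_pmf (step_pmf n p))"
proof (rule finite_subset)
  show "set_pmf (step_pmf n p) \<subseteq> {2..n} \<times> Pow {1..n}"
  proof
    fix z assume "z \<in> set_pmf (step_pmf n p)"
    from set_step_pmf[OF this] show "z \<in> {2..n} \<times> Pow {1..n}"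
      by (cases z) auto
  qed
qed simp

lemma expectation_step_pmf:
  fixes g :: "nat \<times> nat set \<Rightarrow> real"
  shows "measure_pmf.expectation (step_pmf n p) g =
    measure_pmf.expectation p
      (\<lambda>k. (\<Sum>A | A \<subseteq> {1..n} \<and> card A = k. g (k, A)) / real (n choose k))"
proof -
  have ne: "finite {A. A \<subseteq> {1..n} \<and> card A = k}" "{A. A \<subseteq> {1..n} \<and> card A = k} \<noteq> {}"
    if "k \<in> set_pmf p" for k
    using blocks_nonempty[of k] p that by auto
  have "measure_pmf.expectation (step_pmf n p) g = (\<Sum>k\<in>set_pmf p. pmf p k *\<^sub>R
      measure_pmf.expectation (map_pmf (Pair k) (pmf_of_set {A. A \<subseteq> {1..n} \<and> card A = k})) g)"
    unfolding step_pmf_def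
    by (rule pmf_expectation_bind[OF finite_set_p _ order_refl])
      (simp add: set_pmf_of_set[OF ne(2,1)] ne(1) del: One_nat_def)
  also have "\<dots> = (\<Sum>k\<in>set_pmf p. pmf p k *\<^sub>R
      ((\<Sum>A | A \<subseteq> {1..n} \<and> card A = k. g (k, A)) / real (n choose k)))"
    by (intro sum.cong refl) (simp add: integral_pmf_of_set[OF ne(2,1)] n_subsets del: One_nat_def)
  also have "\<dots> = measure_pmf.expectation p
      (\<lambda>k. (\<Sum>A | A \<subseteq> {1..n} \<and> card A = k. g (k, A)) / real (n choose k))"
    by (rule integral_measure_pmf[OF finite_set_p, symmetric])
  finally show ?thesis .
qed

text \<open>Turns an update formula for a fixed block into a one-step mean, since each point lies in
  a block of size \<open>k\<close> with probability \<open>k / n\<close>. Here \<open>h\<close> is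
  what the block erases and \<open>h'\<close> what it writes.\<close>

lemma expectation_block_sums:
  fixes c :: real and h h' :: "nat \<Rightarrow> nat \<Rightarrow> real"
  assumes g: "\<And>k A. k \<in> {2..n} \<Longrightarrow> A \<subseteq> {1..n} \<Longrightarrow> card A = k \<Longrightarrow>
    g (k, A) = c - (\<Sum>x\<in>A. h k x) + (\<Sum>x\<in>A. h' k x)"
  shows "measure_pmf.expectation (step_pmf n p) g = measure_pmf.expectation p (\<lambda>k.
    c - real k / real n * (\<Sum>x\<in>{1..n}. h k x) + real k / real n * (\<Sum>x\<in>{1..n}. h' k x))"
  unfolding expectation_step_pmf
proof (rule expectation_pmf_cong)
  fix k assume "k \<in> set_pmf p"
  then have k: "k \<in> {2..n}" using p by blast
  then have pos: "real (n choose k) > 0" by simp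
  have "(\<Sum>A | A \<subseteq> {1..n} \<and> card A = k. g (k, A)) =
      (\<Sum>A | A \<subseteq> {1..n} \<and> card A = k. c - (\<Sum>x\<in>A. h k x) + (\<Sum>x\<in>A. h' k x))"
    using g[OF k] by (intro sum.cong) auto
  also have "\<dots> = real (n choose k) * c
      - real ((n - 1) choose (k - 1)) * (\<Sum>x\<in>{1..n}. h k x)
      + real ((n - 1) choose (k - 1)) * (\<Sum>x\<in>{1..n}. h' k x)"
    using k by (simp add: sum.distrib sum_subtractf n_subsets sum_subsets_sum[of "{1..n}" k, simplified])
  finally have "(\<Sum>A | A \<subseteq> {1..n} \<and> card A = k. g (k, A)) / real (n choose k) = c
      - real ((n - 1) choose (k - 1)) / real (n choose k) * (\<Sum>x\<in>{1..n}. h k x)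
      + real ((n - 1) choose (k - 1)) / real (n choose k) * (\<Sum>x\<in>{1..n}. h' k x)"
    using pos by (simp add: add_divide_distrib diff_divide_distrib)
  then show "(\<Sum>A | A \<subseteq> {1..n} \<and> card A = k. g (k, A)) / real (n choose k) =
      c - real k / real n * (\<Sum>x\<in>{1..n}. h k x) + real k / real n * (\<Sum>x\<in>{1..n}. h' k x)"
    using k by (subst (asm) (1 2) binomial_ratio_1) auto
qed

text \<open>Second-moment analogue. The division by \<open>k\<close> from averaging reduces the
  one-point probability to \<open>1 / n\<close> and the two-point probability to
  \<open>(k - 1) / (n (n - 1))\<close>.\<close>

lemma expectation_block_squares:
  fixes c :: real and h h' :: "nat \<Rightarrow> nat \<Rightarrow> real"
  assumes g: "\<And>k A. k \<in> {2..n} \<Longrightarrow> A \<subseteq> {1..n} \<Longrightarrow> card A = k \<Longrightarrow>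
    g (k, A) = c - (\<Sum>x\<in>A. (h k x)\<^sup>2) + (\<Sum>x\<in>A. h' k x)\<^sup>2 / real k"
  shows "measure_pmf.expectation (step_pmf n p) g = measure_pmf.expectation p (\<lambda>k.
    c - real k / real n * (\<Sum>x\<in>{1..n}. (h k x)\<^sup>2) + (\<Sum>x\<in>{1..n}. (h' k x)\<^sup>2) / real n
      + (real k - 1) / (real n * (real n - 1)) *
        ((\<Sum>x\<in>{1..n}. h' k x)\<^sup>2 - (\<Sum>x\<in>{1..n}. (h' k x)\<^sup>2)))"
  unfolding expectation_step_pmf
proof (rule expectation_pmf_cong)
  fix k assume "k \<in> set_pmf p"
  then have k: "k \<in> {2..n}" using p by blast
  then have pos: "real (n choose k) > 0" by simp
  let ?d = "(\<Sum>x\<in>{1..n}. h' k x)\<^sup>2 - (\<Sum>x\<in>{1..n}. (h' k x)\<^sup>2)"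
  have "(\<Sum>A | A \<subseteq> {1..n} \<and> card A = k. g (k, A)) =
      (\<Sum>A | A \<subseteq> {1..n} \<and> card A = k. c - (\<Sum>x\<in>A. (h k x)\<^sup>2) + (\<Sum>x\<in>A. h' k x)\<^sup>2 / real k)"
    using g[OF k] by (intro sum.cong) auto
  also have "\<dots> = real (n choose k) * c
      - real ((n - 1) choose (k - 1)) * (\<Sum>x\<in>{1..n}. (h k x)\<^sup>2)
      + (real ((n - 1) choose (k - 1)) * (\<Sum>x\<in>{1..n}. (h' k x)\<^sup>2)
        + real ((n - 2) choose (k - 2)) * ?d) / real k"
    using k by (simp add: sum.distrib sum_subtractf n_subsets sum_subsets_sum[of "{1..n}" k, simplified]
      sum_subsets_sum_sq[of "{1..n}" k, simplified] flip: sum_divide_distrib)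
  finally have sum_eq: "(\<Sum>A | A \<subseteq> {1..n} \<and> card A = k. g (k, A)) = \<dots>" .
  have "(\<Sum>A | A \<subseteq> {1..n} \<and> card A = k. g (k, A)) / real (n choose k) = c
      - real ((n - 1) choose (k - 1)) / real (n choose k) * (\<Sum>x\<in>{1..n}. (h k x)\<^sup>2)
      + (real ((n - 1) choose (k - 1)) / real (n choose k) * (\<Sum>x\<in>{1..n}. (h' k x)\<^sup>2)
      + real ((n - 2) choose (k - 2)) / real (n choose k) * ?d) / real k"
  proof -
    have "(N * c - a * H + (a * S + b * D) / m) / N = c - a / N * H + (a / N * S + b / N * D) / m"
      if "N > 0" "m > 0" for N a b H S D m :: real
      using that by (simp add: field_simps)
    from this[OF pos, of "real k"] k show ?thesis
      unfolding sum_eq by simp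
  qed
  also have "real ((n - 1) choose (k - 1)) / real (n choose k) = real k / real n"
    using k by (intro binomial_ratio_1) auto
  also have "real ((n - 2) choose (k - 2)) / real (n choose k) = real k * (real k - 1) / (real n * (real n - 1))"
    using k by (intro binomial_ratio_2) auto
  finally show "(\<Sum>A | A \<subseteq> {1..n} \<and> card A = k. g (k, A)) / real (n choose k) =
      c - real k / real n * (\<Sum>x\<in>{1..n}. (h k x)\<^sup>2) + (\<Sum>x\<in>{1..n}. (h' k x)\<^sup>2) / real n
      + (real k - 1) / (real n * (real n - 1)) * ?d"
    using k by (simp add: add_divide_distrib)
qed

text \<open>The law of the size of the block containing a tagged particle; the value 1 stands for a step
  in which the particle lies in no block.\<close>

definition hit_pmf :: "nat pmf" where
  "hit_pmf = bind_pmf p (\<lambda>k. map_pmf (\<lambda>b. if b then k else 1) (bernoulli_pmf (real k / real n)))"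

lemma finite_set_hit: "finite (set_pmf hit_pmf)"
  unfolding hit_pmf_def using finite_set_p by simp

lemma expectation_hit_pmf:
  fixes g :: "nat \<Rightarrow> real"
  shows "measure_pmf.expectation hit_pmf g =
    measure_pmf.expectation p (\<lambda>k. (1 - real k / real n) * g 1 + real k / real n * g k)"
proof -
  \<comment> \<open>\<open>bernoulli_pmf\<close> clamps its parameter to the unit interval, so the
    formula depends on this bound.\<close>
  have "real k / real n \<le> 1" if "k \<in> set_pmf p" for k
    using p that n by (auto simp: divide_le_eq)
  then show ?thesis
    unfolding hit_pmf_def
    by (subst pmf_expectation_bind[OF finite_set_p _ order_refl], simp,
        subst integral_measure_pmf[OF finite_set_p])
      (auto intro!: sum.cong)
qed

section \<open>First and second moments of the weighted mass\<close>

lemmas expectation_step_Suc = expectation_iid_path_Suc[OF finite_set_step]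
lemmas expectation_mono_path = expectation_pmf_mono[OF finite_set_iid_path[OF finite_set_step]]

lemma integrable_step_path: "integrable (measure_pmf (iid_path (step_pmf n p) t)) (f :: _ \<Rightarrow> real)"
  by (rule integrable_measure_pmf_finite[OF finite_set_iid_path[OF finite_set_step]])

text \<open>A many-to-one formula. A block of size \<open>k\<close> contains the particle with
  probability \<open>k / n\<close> wherever the particle is, so the sizes it meets are independent
  draws from \<open>hit_pmf\<close>.\<close>

lemma expectation_sum_weighted_mass:
  "measure_pmf.expectation (iid_path (step_pmf n p) t) (\<lambda>\<omega>. \<Sum>x\<in>{1..n}. weighted_mass x\<^sub>0 \<omega> t f x) =
   measure_pmf.expectation (iid_path hit_pmf t) (\<lambda>\<omega>. f (\<Sum>s\<in>{1..t}. ln (real (\<omega> s))))"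
proof -
  let ?T = "\<lambda>f a. measure_pmf.expectation hit_pmf (\<lambda>z. f (a + ln (real z)))"
  have eq: "(?T ^^ t) f a =
      measure_pmf.expectation (iid_path hit_pmf t) (\<lambda>\<omega>. f (a + (\<Sum>s\<in>{1..t}. ln (real (\<omega> s)))))"
    for t a and f :: "real \<Rightarrow> real"
    using expectation_iid_path_sum[OF finite_set_hit, of t f a "\<lambda>k. ln (real k)"] by simp
  \<comment> \<open>Shifting the weight function amounts to starting the walk elsewhere; this makes
    the induction hypothesis usable for the shifted weights.\<close>
  have shift: "(?T ^^ t) (\<lambda>a. f (a + b)) 0 = (?T ^^ t) f b" for t b and f :: "real \<Rightarrow> real"
    unfolding eq by (simp add: add_ac)
  have "measure_pmf.expectation (iid_path (step_pmf n p) t)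
      (\<lambda>\<omega>. \<Sum>x\<in>{1..n}. weighted_mass x\<^sub>0 \<omega> t f x) = (?T ^^ t) f 0"
  proof (induction t arbitrary: f)
    case 0
    then show ?case using x0 by (simp add: dirac_def if_distrib if_distribR cong: if_cong)
  next
    case (Suc t)
    let ?S = "\<lambda>\<omega> f. \<Sum>x\<in>{1..n}. weighted_mass x\<^sub>0 \<omega> t f x"
    have "measure_pmf.expectation (step_pmf n p)
        (\<lambda>z. \<Sum>x\<in>{1..n}. weighted_mass x\<^sub>0 (fun_upd \<omega> (Suc t) z) (Suc t) f x) =
      measure_pmf.expectation p (\<lambda>k. ?S \<omega> f - real k / real n * ?S \<omega> f
        + real k / real n * ?S \<omega> (\<lambda>a. f (a + ln (real k))))" for \<omega>
    proof (rule expectation_block_sums)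
      fix k A assume "k \<in> {2..n}" "A \<subseteq> {1..n}" "card A = k"
      then have "A \<noteq> {}" by auto
      with \<open>A \<subseteq> {1..n}\<close> \<open>card A = k\<close>
      show "(\<Sum>x\<in>{1..n}. weighted_mass x\<^sub>0 (fun_upd \<omega> (Suc t) (k, A)) (Suc t) f x) =
        ?S \<omega> f - (\<Sum>x\<in>A. weighted_mass x\<^sub>0 \<omega> t f x)
          + (\<Sum>x\<in>A. weighted_mass x\<^sub>0 \<omega> t (\<lambda>a. f (a + ln (real k))) x)"
        by (subst sum_weighted_mass_Suc[where A = A]) simp_all
    qed
    then have "measure_pmf.expectation (iid_path (step_pmf n p) (Suc t))
        (\<lambda>\<omega>. \<Sum>x\<in>{1..n}. weighted_mass x\<^sub>0 \<omega> (Suc t) f x) =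
      measure_pmf.expectation p (\<lambda>k. measure_pmf.expectation (iid_path (step_pmf n p) t)
        (\<lambda>\<omega>. ?S \<omega> f - real k / real n * ?S \<omega> f
        + real k / real n * ?S \<omega> (\<lambda>a. f (a + ln (real k)))))"
      unfolding expectation_step_Suc
      by (simp only: expectation_pmf_swap[OF finite_set_p finite_set_iid_path[OF finite_set_step]])
    also have "\<dots> = measure_pmf.expectation p (\<lambda>k. (?T ^^ t) f 0 - real k / real n * (?T ^^ t) f 0
        + real k / real n * (?T ^^ t) f (ln (real k)))"
      unfolding shift[symmetric, of t f "ln _"] Suc.IH[symmetric]
      by (simp only: Bochner_Integration.integral_add Bochner_Integration.integral_diff
          Bochner_Integration.integral_mult_right_zero integrable_step_path)
    \<comment> \<open>Mass outside the block corresponds to the value 1 of \<open>hit_pmf\<close>,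
      which adds \<open>ln 1 = 0\<close>.\<close>
    also have "\<dots> = ?T ((?T ^^ t) f) 0"
      unfolding expectation_hit_pmf by (simp add: algebra_simps)
    finally show ?case by simp
  qed
  then show ?thesis by (simp add: eq)
qed

lemma valid_path:
  assumes "\<omega> \<in> set_pmf (iid_path (step_pmf n p) t)" "s \<in> {1..t}"
  shows "snd (\<omega> s) \<subseteq> {1..n}" "card (snd (\<omega> s)) \<in> {2..n}" "snd (\<omega> s) \<noteq> {}"
  using set_step_pmf[OF set_iid_path[OF assms]] by auto

lemma sum_block_process:
  assumes "\<And>s. s \<in> {1..t} \<Longrightarrow> snd (\<omega> s) \<subseteq> {1..n} \<and> snd (\<omega> s) \<noteq> {}"
  shows "(\<Sum>x\<in>{1..n}. block_process x\<^sub>0 \<omega> t x) = 1"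
  using assms
proof (induction t)
  case 0
  then show ?case using x0 by (simp add: dirac_def)
next
  case (Suc t)
  have "(\<Sum>x\<in>{1..n}. weighted_mass x\<^sub>0 \<omega> (Suc t) (\<lambda>_. 1) x) = (\<Sum>x\<in>{1..n}. weighted_mass x\<^sub>0 \<omega> t (\<lambda>_. 1) x)"
    using Suc.prems[of "Suc t"] by (subst sum_weighted_mass_Suc[OF refl]) auto
  with Suc show ?case unfolding weighted_mass_1 by auto
qed

lemma sum_weighted_mass_le_1:
  assumes "\<omega> \<in> set_pmf (iid_path (step_pmf n p) t)" "\<And>a. f a \<le> 1"
  shows "(\<Sum>x\<in>{1..n}. weighted_mass x\<^sub>0 \<omega> t f x) \<le> 1"
proof -
  have "(\<Sum>x\<in>{1..n}. weighted_mass x\<^sub>0 \<omega> t f x) \<le> (\<Sum>x\<in>{1..n}. block_process x\<^sub>0 \<omega> t x)"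
    by (intro sum_mono weighted_mass_le_block_process assms)
  also have "\<dots> = 1"
    using valid_path[OF assms(1)] by (intro sum_block_process) auto
  finally show ?thesis .
qed

text \<open>In terms of two particles moving independently in the same environment, \<open>C\<close> accounts for the
  event that they have never separated, which has conditional probability \<open>exp (-a)\<close> given the blocks
  met, and \<open>1 / (n - 1)\<close> for all later encounters.\<close>

lemma expectation_sum_weighted_mass_sq:
  assumes f: "\<And>a. 0 \<le> f a" "\<And>a. f a \<le> 1" "\<And>a. (f a)\<^sup>2 \<le> C * exp a"
  shows "measure_pmf.expectation (iid_path (step_pmf n p) t)
    (\<lambda>\<omega>. \<Sum>x\<in>{1..n}. (weighted_mass x\<^sub>0 \<omega> t f x)\<^sup>2) \<le> C + 1 / (real n - 1)"
  using f
proof (induction t arbitrary: f C)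
  case 0
  have "(\<Sum>x\<in>{1..n}. (dirac x\<^sub>0 x * f 0)\<^sup>2) = (f 0)\<^sup>2"
    using x0 by (simp add: dirac_def power_mult_distrib if_distrib if_distribR cong: if_cong)
  then show ?case
    using 0(3)[of 0] n by (simp add: add_increasing2)
next
  case (Suc t)
  let ?v = "1 / (real n - 1)"
  let ?P = "iid_path (step_pmf n p) t"
  let ?Q = "\<lambda>\<omega> f. \<Sum>x\<in>{1..n}. (weighted_mass x\<^sub>0 \<omega> t f x)\<^sup>2"
  let ?f = "\<lambda>k a. f (a + ln (real k))"
  have n1: "real n - 1 > 0" using n by simp
  have f_bounds: "0 \<le> ?f k a" "?f k a \<le> 1" for k a
    using Suc.prems by auto
  have "measure_pmf.expectation (step_pmf n p)
      (\<lambda>z. \<Sum>x\<in>{1..n}. (weighted_mass x\<^sub>0 (fun_upd \<omega> (Suc t) z) (Suc t) f x)\<^sup>2)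
    \<le> measure_pmf.expectation p (\<lambda>k. (1 - real k / real n) * ?Q \<omega> f + ?Q \<omega> (?f k) / real n +
        (real k - 1) / (real n * (real n - 1)))" if \<omega>: "\<omega> \<in> set_pmf ?P" for \<omega>
  proof -
    have "measure_pmf.expectation (step_pmf n p)
        (\<lambda>z. \<Sum>x\<in>{1..n}. (weighted_mass x\<^sub>0 (fun_upd \<omega> (Suc t) z) (Suc t) f x)\<^sup>2) =
      measure_pmf.expectation p (\<lambda>k. ?Q \<omega> f - real k / real n * ?Q \<omega> f + ?Q \<omega> (?f k) / real n
        + (real k - 1) / (real n * (real n - 1)) *
          ((\<Sum>x\<in>{1..n}. weighted_mass x\<^sub>0 \<omega> t (?f k) x)\<^sup>2 - ?Q \<omega> (?f k)))"
    proof (rule expectation_block_squares)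
      fix k A assume "k \<in> {2..n}" "A \<subseteq> {1..n}" "card A = k"
      then have "A \<noteq> {}" by auto
      with \<open>A \<subseteq> {1..n}\<close> \<open>card A = k\<close>
      show "(\<Sum>x\<in>{1..n}. (weighted_mass x\<^sub>0 (fun_upd \<omega> (Suc t) (k, A)) (Suc t) f x)\<^sup>2) =
        ?Q \<omega> f - (\<Sum>x\<in>A. (weighted_mass x\<^sub>0 \<omega> t f x)\<^sup>2)
          + (\<Sum>x\<in>A. weighted_mass x\<^sub>0 \<omega> t (?f k) x)\<^sup>2 / real k"
        by (subst sum_weighted_mass_sq_Suc[where A = A]) simp_all
    qed
    also have "\<dots> \<le> measure_pmf.expectation p (\<lambda>k. (1 - real k / real n) * ?Q \<omega> f
        + ?Q \<omega> (?f k) / real n + (real k - 1) / (real n * (real n - 1)))"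
    proof (rule expectation_pmf_mono[OF finite_set_p])
      fix k assume "k \<in> set_pmf p"
      then have k: "k \<in> {2..n}" using p by blast
      have "(\<Sum>x\<in>{1..n}. weighted_mass x\<^sub>0 \<omega> t (?f k) x)\<^sup>2 \<le> 1\<^sup>2"
        by (intro power_mono sum_weighted_mass_le_1[OF \<omega>] sum_nonneg weighted_mass_nonneg f_bounds)
      moreover have "?Q \<omega> (?f k) \<ge> 0"
        by (intro sum_nonneg) auto
      ultimately have "(real k - 1) / (real n * (real n - 1)) *
          ((\<Sum>x\<in>{1..n}. weighted_mass x\<^sub>0 \<omega> t (?f k) x)\<^sup>2 - ?Q \<omega> (?f k)) \<le>
          (real k - 1) / (real n * (real n - 1)) * 1"
        using k n1 by (intro mult_left_mono) auto
      then show "?Q \<omega> f - real k / real n * ?Q \<omega> f + ?Q \<omega> (?f k) / real n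
        + (real k - 1) / (real n * (real n - 1)) *
          ((\<Sum>x\<in>{1..n}. weighted_mass x\<^sub>0 \<omega> t (?f k) x)\<^sup>2 - ?Q \<omega> (?f k)) \<le>
        (1 - real k / real n) * ?Q \<omega> f
        + ?Q \<omega> (?f k) / real n + (real k - 1) / (real n * (real n - 1))"
        by (simp add: left_diff_distrib)
    qed
    finally show ?thesis .
  qed
  then have "measure_pmf.expectation (iid_path (step_pmf n p) (Suc t))
      (\<lambda>\<omega>. \<Sum>x\<in>{1..n}. (weighted_mass x\<^sub>0 \<omega> (Suc t) f x)\<^sup>2) \<le>
    measure_pmf.expectation ?P (\<lambda>\<omega>. measure_pmf.expectation p (\<lambda>k. (1 - real k / real n) * ?Q \<omega> f
        + ?Q \<omega> (?f k) / real n + (real k - 1) / (real n * (real n - 1))))"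
    unfolding expectation_step_Suc by (intro expectation_mono_path)
  also have "\<dots> = measure_pmf.expectation p (\<lambda>k. measure_pmf.expectation ?P
      (\<lambda>\<omega>. (1 - real k / real n) * ?Q \<omega> f
        + ?Q \<omega> (?f k) / real n + (real k - 1) / (real n * (real n - 1))))"
    by (rule expectation_pmf_swap[OF finite_set_iid_path[OF finite_set_step] finite_set_p])
  also have "\<dots> = measure_pmf.expectation p (\<lambda>k. (1 - real k / real n) * measure_pmf.expectation ?P (\<lambda>\<omega>. ?Q \<omega> f)
      + measure_pmf.expectation ?P (\<lambda>\<omega>. ?Q \<omega> (?f k)) / real n + (real k - 1) / (real n * (real n - 1)))"
    by (simp only: Bochner_Integration.integral_add Bochner_Integration.integral_mult_right_zero
        Bochner_Integration.integral_divide_zero integrable_step_path)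
      simp
  also have "\<dots> \<le> measure_pmf.expectation p (\<lambda>k. C + ?v)"
  proof (rule expectation_pmf_mono[OF finite_set_p])
    fix k assume "k \<in> set_pmf p"
    then have k: "k \<in> {2..n}" using p by blast
    then have k1: "real k / real n \<le> 1" by (auto simp: divide_le_eq)
    have "measure_pmf.expectation ?P (\<lambda>\<omega>. ?Q \<omega> f) \<le> C + ?v"
      using Suc.prems by (rule Suc.IH)
    \<comment> \<open>Shifting the weight by \<open>ln k\<close> multiplies the admissible constant
      by \<open>k\<close>, because \<open>exp (ln k) = k\<close>.\<close>
    moreover have "measure_pmf.expectation ?P (\<lambda>\<omega>. ?Q \<omega> (?f k)) \<le> C * real k + ?v"
    proof (rule Suc.IH)
      show "(?f k a)\<^sup>2 \<le> C * real k * exp a" for a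
        using Suc.prems(3)[of "a + ln (real k)"] k by (simp add: exp_add mult_ac)
    qed (use f_bounds in auto)
    ultimately have "(1 - real k / real n) * measure_pmf.expectation ?P (\<lambda>\<omega>. ?Q \<omega> f)
        + measure_pmf.expectation ?P (\<lambda>\<omega>. ?Q \<omega> (?f k)) / real n + (real k - 1) / (real n * (real n - 1))
      \<le> (1 - real k / real n) * (C + ?v) + (C * real k + ?v) / real n
        + (real k - 1) / (real n * (real n - 1))"
      using k1 by (intro add_right_mono add_mono mult_left_mono divide_right_mono) auto
    \<comment> \<open>Both contributions are stationary: the gain \<open>C k / n\<close> replaces
      the loss \<open>C k / n\<close>, and \<open>1 / (n - 1)\<close> is the fixed point of the
      remaining affine recursion.\<close>
    also have "\<dots> = C + ?v"
    proof -
      define m where "m = real n - 1"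
      have "m > 0" "real n = m + 1" using n by (auto simp: m_def)
      then show ?thesis by (simp add: divide_simps) (simp add: algebra_simps)
    qed
    finally show "(1 - real k / real n) * measure_pmf.expectation ?P (\<lambda>\<omega>. ?Q \<omega> f)
        + measure_pmf.expectation ?P (\<lambda>\<omega>. ?Q \<omega> (?f k)) / real n + (real k - 1) / (real n * (real n - 1))
      \<le> C + ?v" .
  qed
  finally show ?case by simp
qed

section \<open>Total variation distance in terms of the weighted mass\<close>

lemma finite_steps: "finite (set_pmf (iid_path (step_pmf n p) t))"
  by (rule finite_set_iid_path[OF finite_set_step])

lemma integral_d_TV:
  "(LINT \<omega>|iid_seq (step_pmf n p). d_TV n x\<^sub>0 t \<omega>) =
   measure_pmf.expectation (iid_path (step_pmf n p) t) (d_TV n x\<^sub>0 t)"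
proof (rule integral_iid_seq[OF finite_set_step measurable_d_TV])
  fix \<omega> :: "nat \<Rightarrow> nat \<times> nat set"
  have "\<bar>block_process x\<^sub>0 \<omega> t x - 1 / real n\<bar> \<le> 1" for x
  proof -
    have "0 \<le> 1 / real n" "1 / real n \<le> 1" using n by auto
    then show ?thesis
      using block_process_nonneg[of x\<^sub>0 \<omega> t x] block_process_le_1[of x\<^sub>0 \<omega> t x] by linarith
  qed
  then have "(\<Sum>x\<in>{1..n}. \<bar>block_process x\<^sub>0 \<omega> t x - 1 / real n\<bar>) \<le> (\<Sum>x\<in>{1..n}. 1)"
    by (intro sum_mono)
  moreover have "0 \<le> (\<Sum>x\<in>{1..n}. \<bar>block_process x\<^sub>0 \<omega> t x - 1 / real n\<bar>)"
    by (intro sum_nonneg) simp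
  ultimately show "\<bar>d_TV n x\<^sub>0 t \<omega>\<bar> \<le> real n"
    by (simp add: d_TV_def tv_norm_def)
next
  fix \<omega> \<omega>' :: "nat \<Rightarrow> nat \<times> nat set"
  assume "\<And>s. s \<in> {1..t} \<Longrightarrow> \<omega> s = \<omega>' s"
  then show "d_TV n x\<^sub>0 t \<omega> = d_TV n x\<^sub>0 t \<omega>'"
    using weighted_mass_cong[of t \<omega> \<omega>' x\<^sub>0 "\<lambda>_. 1"]
    by (simp add: d_TV_def tv_norm_def weighted_mass_1)
qed

text \<open>The test set \<open>B\<close> of points with mass at least \<open>exp (- b)\<close> has
  at most \<open>exp b\<close> elements, yet it carries all the mass of weight at most
  \<open>b\<close>.\<close>

lemma d_TV_ge:
  assumes \<omega>: "\<omega> \<in> set_pmf (iid_path (step_pmf n p) t)"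
  shows "d_TV n x\<^sub>0 t \<omega> \<ge>
    (\<Sum>x\<in>{1..n}. weighted_mass x\<^sub>0 \<omega> t (\<lambda>a. if a \<le> b then 1 else 0) x) - exp b / real n"
proof -
  let ?\<eta> = "block_process x\<^sub>0 \<omega> t"
  let ?w = "weighted_mass x\<^sub>0 \<omega> t (\<lambda>a. if a \<le> b then 1 else 0)"
  define B where "B = {x \<in> {1..n}. exp (- b) \<le> ?\<eta> x}"
  have B: "B \<subseteq> {1..n}" by (auto simp: B_def)
  have valid: "snd (\<omega> s) \<subseteq> {1..n} \<and> snd (\<omega> s) \<noteq> {}" if "s \<in> {1..t}" for s
    using valid_path[OF \<omega> that] by auto
  have sum1: "(\<Sum>x\<in>{1..n}. ?\<eta> x) = 1"
    by (rule sum_block_process[OF valid])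
  have "real (card B) * exp (- b) = (\<Sum>x\<in>B. exp (- b))"
    by simp
  also have "\<dots> \<le> (\<Sum>x\<in>B. ?\<eta> x)"
    by (intro sum_mono) (auto simp: B_def)
  also have "\<dots> \<le> (\<Sum>x\<in>{1..n}. ?\<eta> x)"
    using B by (intro sum_mono2 block_process_nonneg) auto
  finally have cardB: "real (card B) \<le> exp b"
    unfolding sum1 by (simp add: exp_minus field_simps)
  have "(\<Sum>x\<in>{1..n}. ?w x) = (\<Sum>x\<in>B. ?w x)"
  proof (rule sum.mono_neutral_right[OF _ B], simp, intro ballI)
    fix x assume "x \<in> {1..n} - B"
    then have "?\<eta> x < exp (- b)" by (auto simp: B_def)
    then show "?w x = 0"
      using valid by (intro weighted_mass_atMost_eq_0) (auto dest: finite_subset)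
  qed
  also have "\<dots> \<le> (\<Sum>x\<in>B. ?\<eta> x)"
    by (intro sum_mono weighted_mass_le_block_process) simp
  also have "\<dots> = (\<Sum>x\<in>B. ?\<eta> x - 1 / real n) + real (card B) / real n"
    by (simp add: sum_subtractf)
  also have "\<dots> \<le> d_TV n x\<^sub>0 t \<omega> + exp b / real n"
    unfolding d_TV_def using B cardB sum1 n
    by (intro add_mono sum_subset_le_tv_norm divide_right_mono) (auto simp: sum_subtractf)
  finally show ?thesis by simp
qed

text \<open>The remainder of the process after removing \<open>w\<close> is nonnegative and is
  measured by its mass. The distance of \<open>w\<close> from uniform is bounded by its square via
  the AM-GM inequality with parameter \<theta>; no square root appears, so expectations can be taken
  termwise.\<close>

lemma d_TV_le:
  fixes f :: "real \<Rightarrow> real" and \<theta> :: real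
  assumes \<omega>: "\<omega> \<in> set_pmf (iid_path (step_pmf n p) t)" and \<theta>: "\<theta> > 0"
    and f: "\<And>a. f a \<le> 1"
  defines "w \<equiv> weighted_mass x\<^sub>0 \<omega> t f"
  shows "d_TV n x\<^sub>0 t \<omega> \<le> (1 - (\<Sum>x\<in>{1..n}. w x)) / 2 + \<theta> / 4 +
    (real n * (\<Sum>x\<in>{1..n}. (w x)\<^sup>2) - 2 * (\<Sum>x\<in>{1..n}. w x) + 1) / (4 * \<theta>)"
proof -
  let ?\<eta> = "block_process x\<^sub>0 \<omega> t"
  have n0: "real n > 0" using n by simp
  have sum1: "(\<Sum>x\<in>{1..n}. ?\<eta> x) = 1"
    using valid_path[OF \<omega>] by (intro sum_block_process) auto
  have "\<bar>?\<eta> x - 1 / real n\<bar> \<le> ?\<eta> x - w x + \<theta> / (2 * real n) + real n * (w x - 1 / real n)\<^sup>2 / (2 * \<theta>)" for x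
  proof -
    let ?v = "\<bar>w x - 1 / real n\<bar>"
    have "0 \<le> (\<theta> / real n - ?v)\<^sup>2 * (real n / (2 * \<theta>))"
      using \<theta> by simp
    also have "\<dots> = \<theta> / (2 * real n) + real n * ?v\<^sup>2 / (2 * \<theta>) - ?v"
      using \<theta> n0 by (simp add: power2_eq_square field_simps)
    finally have "?v \<le> \<theta> / (2 * real n) + real n * (w x - 1 / real n)\<^sup>2 / (2 * \<theta>)"
      by simp
    moreover have "w x \<le> ?\<eta> x"
      unfolding w_def by (rule weighted_mass_le_block_process) (rule f)
    ultimately show ?thesis by linarith
  qed
  then have "(\<Sum>x\<in>{1..n}. \<bar>?\<eta> x - 1 / real n\<bar>) \<le>
      (\<Sum>x\<in>{1..n}. ?\<eta> x - w x + \<theta> / (2 * real n) + real n * (w x - 1 / real n)\<^sup>2 / (2 * \<theta>))"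
    by (intro sum_mono)
  also have "\<dots> = 1 - (\<Sum>x\<in>{1..n}. w x) + \<theta> / 2
      + real n * (\<Sum>x\<in>{1..n}. (w x - 1 / real n)\<^sup>2) / (2 * \<theta>)"
    using n0 sum1 by (simp add: sum.distrib sum_subtractf sum_distrib_left sum_divide_distrib)
  also have "(\<Sum>x\<in>{1..n}. (w x - 1 / real n)\<^sup>2) =
      (\<Sum>x\<in>{1..n}. (w x)\<^sup>2) - 2 / real n * (\<Sum>x\<in>{1..n}. w x) + 1 / real n"
    using n0 by (simp only: power2_diff sum.distrib sum_subtractf sum_distrib_left)
      (simp add: power2_eq_square mult.commute)
  also have "real n * \<dots> = real n * (\<Sum>x\<in>{1..n}. (w x)\<^sup>2) - 2 * (\<Sum>x\<in>{1..n}. w x) + 1"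
    using n0 by (simp add: algebra_simps)
  finally have *: "(\<Sum>x\<in>{1..n}. \<bar>?\<eta> x - 1 / real n\<bar>) \<le> 1 - (\<Sum>x\<in>{1..n}. w x) + \<theta> / 2
      + (real n * (\<Sum>x\<in>{1..n}. (w x)\<^sup>2) - 2 * (\<Sum>x\<in>{1..n}. w x) + 1) / (2 * \<theta>)" .
  have "1 / 2 * T \<le> (1 - S) / 2 + \<theta> / 4 + G / (4 * \<theta>)" if "T \<le> 1 - S + \<theta> / 2 + G / (2 * \<theta>)" for T S G
    using that by (simp add: field_simps)
  from this[OF *] show ?thesis
    unfolding d_TV_def tv_norm_def .
qed

abbreviation (input) hit_sum :: "nat \<Rightarrow> (real \<Rightarrow> real) \<Rightarrow> real" where
  "hit_sum t f \<equiv> measure_pmf.expectation (iid_path hit_pmf t) (\<lambda>\<omega>. f (\<Sum>s\<in>{1..t}. ln (real (\<omega> s))))"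

lemma expectation_d_TV_ge:
  "measure_pmf.expectation (iid_path (step_pmf n p) t) (d_TV n x\<^sub>0 t) \<ge>
    hit_sum t (\<lambda>a. if a \<le> b then 1 else 0) - exp b / real n"
proof -
  have "hit_sum t (\<lambda>a. if a \<le> b then 1 else 0) - exp b / real n =
    measure_pmf.expectation (iid_path (step_pmf n p) t) (\<lambda>\<omega>.
      (\<Sum>x\<in>{1..n}. weighted_mass x\<^sub>0 \<omega> t (\<lambda>a. if a \<le> b then 1 else 0) x) - exp b / real n)"
    by (subst expectation_sum_weighted_mass[symmetric])
      (subst Bochner_Integration.integral_diff, simp_all only: integrable_step_path, simp)
  also have "\<dots> \<le> measure_pmf.expectation (iid_path (step_pmf n p) t) (d_TV n x\<^sub>0 t)"
    by (intro expectation_pmf_mono finite_steps d_TV_ge)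
  finally show ?thesis .
qed

lemma expectation_d_TV_le:
  fixes b \<theta> :: real and t :: nat
  assumes \<theta>: "\<theta> > 0"
  defines "r \<equiv> 1 - hit_sum t (\<lambda>a. if b \<le> a then 1 else 0)"
  shows "measure_pmf.expectation (iid_path (step_pmf n p) t) (d_TV n x\<^sub>0 t) \<le>
    r / 2 + \<theta> / 4 + (real n * exp (- b) + 1 / (real n - 1) + 2 * r) / (4 * \<theta>)"
proof -
  let ?f = "\<lambda>a. if b \<le> a then 1 else 0 :: real"
  let ?E = "measure_pmf.expectation (iid_path (step_pmf n p) t)"
  have n0: "real n > 0" "real n - 1 > 0" using n by auto
  have S: "?E (\<lambda>\<omega>. \<Sum>x\<in>{1..n}. weighted_mass x\<^sub>0 \<omega> t ?f x) = 1 - r"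
    by (simp only: expectation_sum_weighted_mass r_def diff_diff_eq2)
  have Q: "?E (\<lambda>\<omega>. \<Sum>x\<in>{1..n}. (weighted_mass x\<^sub>0 \<omega> t ?f x)\<^sup>2) \<le> exp (- b) + 1 / (real n - 1)"
  proof (rule expectation_sum_weighted_mass_sq)
    \<comment> \<open>On the set where the indicator is 1 one has \<open>b \<le> a\<close>, so
      \<open>C = exp (- b)\<close> is admissible.\<close>
    show "(?f a)\<^sup>2 \<le> exp (- b) * exp a" for a
      by (simp add: exp_add[symmetric])
  qed auto
  have "?E (d_TV n x\<^sub>0 t) \<le> ?E (\<lambda>\<omega>. (1 - (\<Sum>x\<in>{1..n}. weighted_mass x\<^sub>0 \<omega> t ?f x)) / 2 + \<theta> / 4 +
    (real n * (\<Sum>x\<in>{1..n}. (weighted_mass x\<^sub>0 \<omega> t ?f x)\<^sup>2)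
      - 2 * (\<Sum>x\<in>{1..n}. weighted_mass x\<^sub>0 \<omega> t ?f x) + 1) / (4 * \<theta>))"
    by (intro expectation_pmf_mono finite_steps d_TV_le \<theta>) auto
  also have "\<dots> = r / 2 + \<theta> / 4 +
    (real n * ?E (\<lambda>\<omega>. \<Sum>x\<in>{1..n}. (weighted_mass x\<^sub>0 \<omega> t ?f x)\<^sup>2) - 2 * (1 - r) + 1) / (4 * \<theta>)"
    by (simp only: Bochner_Integration.integral_add Bochner_Integration.integral_diff
      Bochner_Integration.integral_mult_right_zero Bochner_Integration.integral_divide_zero
      integrable_step_path S) simp
  also have "\<dots> \<le> r / 2 + \<theta> / 4 +
    (real n * (exp (- b) + 1 / (real n - 1)) - 2 * (1 - r) + 1) / (4 * \<theta>)"
    using Q \<theta> n0 by (intro add_left_mono divide_right_mono add_right_mono diff_right_mono mult_left_mono) auto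
  \<comment> \<open>As \<open>n / (n - 1) = 1 + 1 / (n - 1)\<close>, the leading terms
    \<open>1 - 2 + 1\<close> cancel. This is where the exact constant of the second-moment bound
    matters.\<close>
  also have "real n * (exp (- b) + 1 / (real n - 1)) - 2 * (1 - r) + 1 =
      real n * exp (- b) + 1 / (real n - 1) + 2 * r"
    using n0 by (simp add: field_simps)
  finally show ?thesis .
qed

section \<open>Size biasing and the blocks met by a tagged particle\<close>

abbreviation "mean_size \<equiv> measure_pmf.expectation p real"
abbreviation "q \<equiv> mean_size / real n"
abbreviation "\<mu> \<equiv> mean_log_biased p"

lemma mean_size_bounds: "2 \<le> mean_size" "mean_size \<le> real n"
proof -
  have "measure_pmf.expectation p (\<lambda>_. 2) \<le> mean_size" "mean_size \<le> measure_pmf.expectation p (\<lambda>_. real n)"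
    using p by (intro expectation_pmf_mono finite_set_p; force)+
  then show "2 \<le> mean_size" "mean_size \<le> real n" by simp_all
qed

lemma q_bounds: "0 < q" "q \<le> 1"
  using mean_size_bounds n by (auto simp: divide_le_eq)

lemma set_size_biased: "set_pmf (size_biased p) \<subseteq> {2..n}"
  using p by (auto simp: set_pmf_iff pmf_size_biased[OF p])

lemma finite_set_size_biased: "finite (set_pmf (size_biased p))"
  using set_size_biased finite_subset by blast

lemma expectation_size_biased:
  fixes g :: "nat \<Rightarrow> real"
  shows "measure_pmf.expectation p (\<lambda>k. real k * g k) =
    mean_size * measure_pmf.expectation (size_biased p) g"
proof -
  have "measure_pmf.expectation (size_biased p) g = (\<Sum>k\<in>{2..n}. real k * pmf p k / mean_size * g k)"
    using set_size_biased
    by (subst integral_measure_pmf[of "{2..n}"]) (auto simp: pmf_size_biased[OF p])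
  moreover have "measure_pmf.expectation p (\<lambda>k. real k * g k) = (\<Sum>k\<in>{2..n}. pmf p k * (real k * g k))"
    using p by (subst integral_measure_pmf[of "{2..n}"]) auto
  ultimately show ?thesis
    using mean_size_bounds by (simp add: sum_distrib_left mult_ac)
qed

text \<open>A block meets the particle with probability proportional to its size: a hit has total
  probability \<open>q\<close>, and given a hit the size has the size-biased law.\<close>

lemma expectation_hit_size_biased:
  fixes g :: "nat \<Rightarrow> real"
  shows "measure_pmf.expectation hit_pmf g =
    (1 - q) * g 1 + q * measure_pmf.expectation (size_biased p) g"
proof -
  have "measure_pmf.expectation hit_pmf g =
      measure_pmf.expectation p (\<lambda>k. g 1 - real k * (g 1 / real n) + real k * (g k / real n))"
    unfolding expectation_hit_pmf by (simp add: algebra_simps)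
  also have "\<dots> = g 1 - mean_size * (g 1 / real n) + mean_size * (measure_pmf.expectation (size_biased p) g / real n)"
    using integrable_measure_pmf_finite[OF finite_set_p]
    by (simp add: integrable_p expectation_size_biased del: times_divide_eq_right)
  finally show ?thesis by (simp add: algebra_simps)
qed

lemma finite_hit_path: "finite (set_pmf (iid_path hit_pmf t))"
  by (rule finite_set_iid_path[OF finite_set_hit])

lemma \<mu>_pos: "\<mu> > 0"
proof -
  have "measure_pmf.expectation (size_biased p) (\<lambda>_. ln 2) \<le> \<mu>"
    unfolding mean_log_biased_def using set_size_biased
    by (intro expectation_pmf_mono finite_set_size_biased) force
  moreover have "ln (2::real) > 0" by simp
  ultimately show ?thesis by (simp del: ln_gt_zero_iff)
qed

section \<open>Concentration of the logarithmic weight\<close>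

text \<open>Genuine block sizes are at least 2, so \<open>k = 1\<close> marks a step without a hit,
  which must add no fluctuation.\<close>

definition log_size_dev :: "nat \<Rightarrow> real" where
  "log_size_dev k = (if k = 1 then 0 else ln (real k) - \<mu>)"

sublocale size: centered_pmf "size_biased p" "\<lambda>k. ln (real k) - \<mu>"
  by unfold_locales (simp_all add: finite_set_size_biased mean_log_biased_def
    integrable_measure_pmf_finite[OF finite_set_size_biased])

lemma expectation_hit_log_size_dev:
  "measure_pmf.expectation hit_pmf (\<lambda>k. g (a + log_size_dev k)) =
    (1 - q) * g a + q * measure_pmf.expectation (size_biased p) (\<lambda>k. g (a + (ln (real k) - \<mu>)))"
proof -
  have "measure_pmf.expectation (size_biased p) (\<lambda>k. g (a + log_size_dev k)) =
      measure_pmf.expectation (size_biased p) (\<lambda>k. g (a + (ln (real k) - \<mu>)))"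
    using set_size_biased by (intro expectation_pmf_cong) (auto simp: log_size_dev_def)
  then show ?thesis
    unfolding expectation_hit_size_biased by (simp add: log_size_dev_def)
qed

text \<open>The number of hits is random with mean \<open>t q\<close>. Since the bound on
  \<open>size.abs_dev\<close> is affine in the number of summands, averaging over the hits simply
  inserts this mean.\<close>

lemma abs_dev_hit_le:
  assumes "K > 0"
  shows "measure_pmf.expectation (iid_path hit_pmf t) (\<lambda>\<omega>. \<bar>\<Sum>s\<in>{1..t}. log_size_dev (\<omega> s)\<bar>)
    \<le> (real t * q / real K + 1) * size.abs_dev K"
proof -
  let ?T = "\<lambda>g a. measure_pmf.expectation hit_pmf (\<lambda>z. g (a + log_size_dev z))"
  let ?U = "\<lambda>g a. measure_pmf.expectation (size_biased p) (\<lambda>k. g (a + (ln (real k) - \<mu>)))"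
  have eqT: "(?T ^^ t) g a =
      measure_pmf.expectation (iid_path hit_pmf t) (\<lambda>\<omega>. g (a + (\<Sum>s\<in>{1..t}. log_size_dev (\<omega> s))))"
    for t a and g :: "real \<Rightarrow> real"
    by (rule expectation_iid_path_sum[OF finite_set_hit, symmetric])
  have eqU: "(?U ^^ t) g a =
      measure_pmf.expectation (iid_path (size_biased p) t) (\<lambda>\<omega>. g (a + (\<Sum>s\<in>{1..t}. ln (real (\<omega> s)) - \<mu>)))"
    for t a and g :: "real \<Rightarrow> real"
    by (rule expectation_iid_path_sum[OF finite_set_size_biased, symmetric])
  have linear: "(?T ^^ t) (\<lambda>a. c * g a + d * h a) a = c * (?T ^^ t) g a + d * (?T ^^ t) h a"
    for t a c d and g h :: "real \<Rightarrow> real"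
    unfolding eqT by (simp add: integrable_measure_pmf_finite[OF finite_hit_path])
  \<comment> \<open>Generalised over the number \<open>i\<close> of hits already accounted for; each
    further step is a miss with probability \<open>1 - q\<close> and raises \<open>i\<close> by one
    with probability \<open>q\<close>.\<close>
  have "(?T ^^ t) ((?U ^^ i) abs) 0 \<le> ((real i + real t * q) / real K + 1) * size.abs_dev K" for i
  proof (induction t arbitrary: i)
    case 0
    have "(?U ^^ i) abs 0 = size.abs_dev i"
      unfolding eqU size.abs_dev_def by simp
    then show ?case
      using size.abs_dev_le[OF assms, of i] by simp
  next
    case (Suc t)
    have "?T ((?U ^^ i) abs) = (\<lambda>a. (1 - q) * (?U ^^ i) abs a + q * (?U ^^ Suc i) abs a)"
      unfolding expectation_hit_log_size_dev funpow.simps o_apply ..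
    then have "(?T ^^ Suc t) ((?U ^^ i) abs) 0 =
        (1 - q) * (?T ^^ t) ((?U ^^ i) abs) 0 + q * (?T ^^ t) ((?U ^^ Suc i) abs) 0"
      unfolding funpow_Suc_right o_apply by (simp only: linear)
    also have "\<dots> \<le> (1 - q) * (((real i + real t * q) / real K + 1) * size.abs_dev K) +
        q * (((real (Suc i) + real t * q) / real K + 1) * size.abs_dev K)"
      using q_bounds by (intro add_mono mult_left_mono Suc.IH) auto
    also have "\<dots> = ((real i + real (Suc t) * q) / real K + 1) * size.abs_dev K"
    proof -
      have "(1 - y) * (((i + t * y) / K + 1) * d) + y * (((1 + i + t * y) / K + 1) * d) =
          ((i + (1 + t) * y) / K + 1) * d" for i t y K d :: real
        by (simp add: divide_inverse algebra_simps)
      from this[of q] show ?thesis by simp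
    qed
    finally show ?case .
  qed
  from this[of 0] show ?thesis
    unfolding eqT by simp
qed

text \<open>The deviation of the logarithmic weight splits into the fluctuation of the block sizes and that
  of the number of hits.\<close>

lemma abs_dev_log_weight:
  assumes "K > 0"
  shows "hit_sum t (\<lambda>a. \<bar>a - real t * q * \<mu>\<bar>) \<le> (real t * q / real K + 1) * size.abs_dev K + \<mu> * sqrt (real t * q)"
proof -
  let ?E = "measure_pmf.expectation (iid_path hit_pmf t)"
  \<comment> \<open>\<mu> times the centred indicator of a hit. Together with
    \<open>log_size_dev\<close> it sums to the centred logarithm \<open>ln k - q \<mu>\<close>, both
    for hits and for misses.\<close>
  define Z where "Z = (\<lambda>k::nat. \<mu> * ((if k = 1 then 0 else 1) - q))"
  have sb: "measure_pmf.expectation (size_biased p) (\<lambda>k. g (if k = 1 then 0 else 1 :: real)) = g 1"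
    for g :: "real \<Rightarrow> real"
  proof -
    have "measure_pmf.expectation (size_biased p) (\<lambda>k. g (if k = 1 then 0 else 1 :: real)) =
        measure_pmf.expectation (size_biased p) (\<lambda>_. g 1)"
      using set_size_biased by (intro expectation_pmf_cong) auto
    then show ?thesis by simp
  qed
  have Z0: "measure_pmf.expectation hit_pmf Z = 0"
    unfolding Z_def expectation_hit_size_biased sb[of "\<lambda>x. \<mu> * (x - q)"]
    by (simp add: divide_inverse algebra_simps)
  have Z: "centered_pmf hit_pmf Z"
    by unfold_locales (fact finite_set_hit, fact Z0)
  have "measure_pmf.expectation hit_pmf (\<lambda>z. (Z z)\<^sup>2) = \<mu>\<^sup>2 * (q * (1 - q))"
    unfolding Z_def expectation_hit_size_biased sb[of "\<lambda>x. (\<mu> * (x - q))\<^sup>2"]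
    by (simp add: power2_eq_square divide_inverse algebra_simps)
  also have "\<dots> \<le> \<mu>\<^sup>2 * q"
    using q_bounds by (intro mult_left_mono mult_left_le) auto
  finally have "?E (\<lambda>\<omega>. (\<Sum>s\<in>{1..t}. Z (\<omega> s))\<^sup>2) \<le> real t * (\<mu>\<^sup>2 * q)"
    unfolding centered_pmf.expectation_sum_iid_path_sq[OF Z] by (intro mult_left_mono) auto
  then have "?E (\<lambda>\<omega>. \<bar>\<Sum>s\<in>{1..t}. Z (\<omega> s)\<bar>) \<le> sqrt (real t * (\<mu>\<^sup>2 * q))"
    using expectation_pmf_abs_le_sqrt[OF finite_hit_path, of t "\<lambda>\<omega>. \<Sum>s\<in>{1..t}. Z (\<omega> s)"]
    by (meson order_trans real_sqrt_le_mono)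
  also have "\<dots> = \<mu> * sqrt (real t * q)"
    using \<mu>_pos real_sqrt_mult[of "\<mu>\<^sup>2" "real t * q"] by (simp add: mult_ac)
  finally have 1: "?E (\<lambda>\<omega>. \<bar>\<Sum>s\<in>{1..t}. Z (\<omega> s)\<bar>) \<le> \<mu> * sqrt (real t * q)" .
  have "hit_sum t (\<lambda>a. \<bar>a - real t * q * \<mu>\<bar>) \<le>
      ?E (\<lambda>\<omega>. \<bar>\<Sum>s\<in>{1..t}. log_size_dev (\<omega> s)\<bar> + \<bar>\<Sum>s\<in>{1..t}. Z (\<omega> s)\<bar>)"
  proof (intro expectation_pmf_mono finite_hit_path)
    fix \<omega> :: "nat \<Rightarrow> nat"
    have "(\<Sum>s\<in>{1..t}. ln (real (\<omega> s))) - real t * q * \<mu> = (\<Sum>s\<in>{1..t}. ln (real (\<omega> s)) - q * \<mu>)"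
      by (simp add: sum_subtractf)
    also have "\<dots> = (\<Sum>s\<in>{1..t}. log_size_dev (\<omega> s) + Z (\<omega> s))"
      by (intro sum.cong refl) (simp add: log_size_dev_def Z_def algebra_simps)
    also have "\<dots> = (\<Sum>s\<in>{1..t}. log_size_dev (\<omega> s)) + (\<Sum>s\<in>{1..t}. Z (\<omega> s))"
      by (rule sum.distrib)
    finally show "\<bar>(\<Sum>s\<in>{1..t}. ln (real (\<omega> s))) - real t * q * \<mu>\<bar> \<le>
        \<bar>\<Sum>s\<in>{1..t}. log_size_dev (\<omega> s)\<bar> + \<bar>\<Sum>s\<in>{1..t}. Z (\<omega> s)\<bar>"
      by (simp only: abs_triangle_ineq)
  qed
  also have "\<dots> = ?E (\<lambda>\<omega>. \<bar>\<Sum>s\<in>{1..t}. log_size_dev (\<omega> s)\<bar>) + ?E (\<lambda>\<omega>. \<bar>\<Sum>s\<in>{1..t}. Z (\<omega> s)\<bar>)"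
    by (intro Bochner_Integration.integral_add integrable_measure_pmf_finite finite_hit_path)
  also have "\<dots> \<le> (real t * q / real K + 1) * size.abs_dev K + \<mu> * sqrt (real t * q)"
    by (intro add_mono 1 abs_dev_hit_le assms)
  finally show ?thesis .
qed

text \<open>Markov's inequality, in the pointwise form
  \<open>1 - \<bar>a - c\<bar> / d \<le> f a\<close>.\<close>

lemma hit_sum_ge:
  assumes d: "d > 0" and f: "\<And>a. \<bar>a - c\<bar> < d \<Longrightarrow> f a = 1" "\<And>a. f a \<ge> 0"
  shows "hit_sum t f \<ge> 1 - hit_sum t (\<lambda>a. \<bar>a - c\<bar>) / d"
proof -
  have "1 - \<bar>a - c\<bar> / d \<le> f a" for a
  proof (cases "\<bar>a - c\<bar> < d")
    case False
    then have "1 \<le> \<bar>a - c\<bar> / d" using d by simp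
    with f(2)[of a] show ?thesis by linarith
  qed (use f(1)[of a] d in simp)
  then have "hit_sum t (\<lambda>a. 1 - \<bar>a - c\<bar> / d) \<le> hit_sum t f"
    by (intro expectation_pmf_mono finite_hit_path)
  then show ?thesis
    by (simp add: integrable_measure_pmf_finite[OF finite_hit_path])
qed

section \<open>Cutoff\<close>

text \<open>The number of summands in the weak law. By time \<open>t_ent n p\<close> a particle
  meets on average \<open>ln n / \<mu>\<close> blocks, which is this number up to rounding.\<close>

definition "K = nat \<lfloor>ln (real n) / \<mu>\<rfloor>"

definition "rel_dev = size.abs_dev K / ln (real n)"

text \<open>The constants are valid up to time \<open>3 t\<^sub>e\<^sub>n\<^sub>t\<close>.\<close>

definition "log_dev = 7 * rel_dev + 2 * sqrt (\<mu> / ln (real n))"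

lemma ln_n_pos: "ln (real n) > 0"
  using n by simp

lemma K_times_\<mu>_le: "real K * \<mu> \<le> ln (real n)"
proof -
  have "real K \<le> ln (real n) / \<mu>"
    unfolding K_def using \<mu>_pos ln_n_pos by (intro of_nat_floor) simp
  then show ?thesis
    using \<mu>_pos by (simp add: pos_le_divide_eq)
qed

text \<open>The centred sum is at least \<open>- ln n\<close>, so convergence in probability controls its negative
  part in \<open>L\<^sup>1\<close>; having mean zero, its positive part is equally small.\<close>

lemma rel_dev_le:
  assumes "\<delta> > 0"
  shows "rel_dev \<le> 2 * \<delta> + 2 * measure (iid_seq (size_biased p))
    {Y \<in> space (iid_seq (size_biased p)).
      \<bar>(1 / ln (real n)) * (\<Sum>s\<in>{1..K}. ln (real (Y s)) - \<mu>)\<bar> > \<delta>}"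
proof -
  let ?M = "iid_seq (size_biased p)"
  let ?S = "\<lambda>Y. \<Sum>s\<in>{1..K}. ln (real (Y s)) - \<mu>"
  let ?A = "{Y \<in> space ?M. \<bar>(1 / ln (real n)) * ?S Y\<bar> > \<delta>}"
  let ?F = "\<lambda>Y. if \<bar>(1 / ln (real n)) * ?S Y\<bar> > \<delta> then 1 else 0 :: real"
  let ?E = "measure_pmf.expectation (iid_path (size_biased p) K)"
  have [measurable]: "(\<lambda>Y. ln (real (Y s))) \<in> borel_measurable ?M" for s
    unfolding iid_seq_def by (rule measurable_compose[OF measurable_component_singleton]) auto
  have A: "?A \<in> sets ?M" and F: "?F \<in> borel_measurable ?M"
    by measurable
  have "measure ?M ?A = (LINT Y|?M. indicator ?A Y)"
    by (subst Bochner_Integration.integral_indicator) (simp add: Int_absorb2)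
  also have "\<dots> = (LINT Y|?M. ?F Y)"
    by (intro Bochner_Integration.integral_cong) (auto simp: indicator_def)
  also have "\<dots> = ?E ?F"
    by (rule integral_iid_seq[OF finite_set_size_biased F, where B = 1]) auto
  finally have P: "measure ?M ?A = ?E ?F" .
  \<comment> \<open>Write the modulus as \<open>S\<close> plus twice the negative part of
    \<open>S\<close>. The negative part is at most \<open>\<delta> ln n\<close> off the exceptional
    event and at most \<open>ln n\<close> on it; \<open>S\<close> itself has mean zero.\<close>
  have "size.abs_dev K \<le> ?E (\<lambda>Y. ?S Y + 2 * \<delta> * ln (real n) + 2 * ln (real n) * ?F Y)"
    unfolding size.abs_dev_def
  proof (intro expectation_pmf_mono finite_set_iid_path finite_set_size_biased)
    fix Y :: "nat \<Rightarrow> nat"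
    \<comment> \<open>True for every \<open>Y\<close>, even outside the support, because
      \<open>ln 0 = 0\<close>.\<close>
    have "(\<Sum>s\<in>{1..K}. 0 - \<mu>) \<le> ?S Y"
      by (intro sum_mono diff_right_mono) (metis ln_ge_zero ln_0 of_nat_0 not_less_eq_eq
          of_nat_1 of_nat_le_iff One_nat_def le_zero_eq order_refl)
    then have lower: "- ln (real n) \<le> ?S Y"
      using K_times_\<mu>_le by simp
    show "\<bar>?S Y\<bar> \<le> ?S Y + 2 * \<delta> * ln (real n) + 2 * ln (real n) * ?F Y"
    proof (cases "\<bar>(1 / ln (real n)) * ?S Y\<bar> > \<delta>")
      case True
      have "0 \<le> \<delta> * ln (real n)"
        using assms ln_n_pos by (intro mult_nonneg_nonneg) auto
      then have "\<bar>?S Y\<bar> \<le> ?S Y + 2 * \<delta> * ln (real n) + 2 * ln (real n)"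
        using lower ln_n_pos by (intro abs_leI) linarith+
      with True show ?thesis by simp
    next
      case False
      then have "\<bar>?S Y\<bar> \<le> \<delta> * ln (real n)"
        using ln_n_pos by (simp add: abs_mult field_simps)
      then show ?thesis
        using False by (simp add: abs_le_iff)
    qed
  qed
  also have "\<dots> = 2 * \<delta> * ln (real n) + 2 * ln (real n) * ?E ?F"
    by (simp only: Bochner_Integration.integral_add Bochner_Integration.integral_mult_right_zero
        size.integrable_iid_path size.expectation_sum_iid_path) simp
  also have "\<dots> = (2 * \<delta> + 2 * ?E ?F) * ln (real n)"
    by (simp add: algebra_simps)
  finally show ?thesis
    unfolding rel_dev_def P using ln_n_pos by (simp add: pos_divide_le_eq)
qed

section \<open>Estimates before and after the entropic time\<close>

abbreviation "T \<equiv> t_ent n p"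

text \<open>The mean logarithmic weight at time \<open>t\<close> is \<open>t q \<mu>\<close>; this
  identifies \<open>T\<close> as the time at which it reaches \<open>ln n\<close>.\<close>

lemma t_ent_eq: "T * (q * \<mu>) = ln (real n)"
proof -
  have "T = real n * ln (real n) / (mean_size * \<mu>)"
    unfolding t_ent_def expectation_size_biased mean_log_biased_def ..
  then show ?thesis
    using mean_size_bounds \<mu>_pos n by simp
qed

text \<open>Follows from \<open>q \<le> 1\<close>. It forces \<open>T\<close> to infinity when \<mu>
  is negligible against \<open>ln n\<close>, so rounding to integer times does not affect the
  ratio.\<close>

lemma t_ent_ge: "ln (real n) / \<mu> \<le> T"
proof -
  have "T * q = ln (real n) / \<mu>"
    using t_ent_eq \<mu>_pos by (simp add: field_simps)
  moreover have "T \<ge> 0"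
    unfolding t_ent_def expectation_size_biased mean_log_biased_def[symmetric]
    using mean_size_bounds \<mu>_pos ln_n_pos by (intro divide_nonneg_nonneg mult_nonneg_nonneg) auto
  ultimately show ?thesis
    using q_bounds mult_left_le[of q T] by simp
qed

context
  assumes small: "\<mu> / ln (real n) \<le> 1 / 2"
begin

text \<open>For \<open>x \<ge> 2\<close> the floor loses at most half, as
  \<open>x - 1 \<ge> x / 2\<close>.\<close>

lemma K_ge: "K \<ge> 1" "ln (real n) / (2 * \<mu>) \<le> real K"
proof -
  define x where "x = ln (real n) / \<mu>"
  have x: "x \<ge> 2"
    using small \<mu>_pos ln_n_pos by (simp add: x_def field_simps)
  moreover have "x - 1 \<le> real K"
    unfolding K_def x_def by linarith
  ultimately have "x / 2 \<le> real K" by linarith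
  with x show "K \<ge> 1" "ln (real n) / (2 * \<mu>) \<le> real K"
    by (simp_all add: x_def mult.commute)
qed

text \<open>Origin of the constants in \<open>log_dev\<close>: up to time \<open>3 T\<close> the
  mean number of hits is at most \<open>6 K\<close>, whence \<open>7 = 6 + 1\<close>; and
  \<open>t q \<mu> \<le> 3 ln n\<close>, relaxed to \<open>4 ln n\<close>, gives the factor
  \<open>2\<close> after the square root.\<close>

lemma hit_sum_dev_le:
  assumes "real t \<le> 3 * T"
  shows "hit_sum t (\<lambda>a. \<bar>a - real t * q * \<mu>\<bar>) \<le> log_dev * ln (real n)"
proof -
  have "real t * (q * \<mu>) \<le> 3 * T * (q * \<mu>)"
    using assms q_bounds \<mu>_pos by (intro mult_right_mono mult_nonneg_nonneg) auto
  then have tq\<mu>: "real t * q * \<mu> \<le> 3 * ln (real n)"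
    by (simp only: mult.assoc t_ent_eq)
  then have "real t * q \<le> 3 * ln (real n) / \<mu>"
    using \<mu>_pos by (simp add: pos_le_divide_eq)
  also have "\<dots> \<le> 6 * real K"
    using K_ge(2) by simp
  finally have "real t * q / real K \<le> 6"
    using K_ge(1) by (subst pos_divide_le_eq) auto
  then have "(real t * q / real K + 1) * size.abs_dev K \<le> 7 * size.abs_dev K"
    by (intro mult_right_mono size.abs_dev_nonneg) simp
  moreover have "\<mu> * sqrt (real t * q) \<le> 2 * sqrt (\<mu> / ln (real n)) * ln (real n)"
  proof (rule power2_le_imp_le)
    have "(\<mu> * sqrt (real t * q))\<^sup>2 = \<mu> * (real t * q * \<mu>)"
    proof -
      have "real t * q \<ge> 0" using q_bounds by (intro mult_nonneg_nonneg) auto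
      then show ?thesis
        unfolding power_mult_distrib real_sqrt_pow2 by (simp add: power2_eq_square mult_ac)
    qed
    also have "\<dots> \<le> \<mu> * (4 * ln (real n))"
      using tq\<mu> \<mu>_pos ln_n_pos by (intro mult_left_mono) auto
    also have "\<dots> = (2 * sqrt (\<mu> / ln (real n)) * ln (real n))\<^sup>2"
      using \<mu>_pos ln_n_pos by (simp add: power_mult_distrib) (simp add: power2_eq_square)
    finally show "(\<mu> * sqrt (real t * q))\<^sup>2 \<le> (2 * sqrt (\<mu> / ln (real n)) * ln (real n))\<^sup>2" .
  qed (use \<mu>_pos ln_n_pos in simp)
  moreover have "7 * size.abs_dev K + 2 * sqrt (\<mu> / ln (real n)) * ln (real n) = log_dev * ln (real n)"
    unfolding log_dev_def rel_dev_def using ln_n_pos by (simp add: algebra_simps)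
  ultimately show ?thesis
    using abs_dev_log_weight[of K t] K_ge(1) by linarith
qed

lemma exp_half_deviation: "exp ((1 - \<delta> / 2) * ln (real n)) / real n = exp (- (\<delta> / 2) * ln (real n))"
  "real n * exp (- ((1 + \<delta> / 2) * ln (real n))) = exp (- (\<delta> / 2) * ln (real n))"
  using n by (simp_all add: algebra_simps exp_diff exp_add exp_minus inverse_eq_divide)

lemma hit_sum_ge_tail:
  assumes t: "real t \<le> 3 * T" and \<delta>: "\<delta> > 0"
    and f: "\<And>a. \<bar>a - real t * q * \<mu>\<bar> < \<delta> / 2 * ln (real n) \<Longrightarrow> f a = 1" "\<And>a. f a \<ge> 0"
  shows "hit_sum t f \<ge> 1 - 2 * log_dev / \<delta>"
proof -
  have "hit_sum t (\<lambda>a. \<bar>a - real t * q * \<mu>\<bar>) / (\<delta> / 2 * ln (real n)) \<le>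
      log_dev * ln (real n) / (\<delta> / 2 * ln (real n))"
    using \<delta> ln_n_pos by (intro divide_right_mono hit_sum_dev_le t) simp
  also have "\<dots> = 2 * log_dev / \<delta>"
    using ln_n_pos by simp
  finally show ?thesis
    using hit_sum_ge[of "\<delta> / 2 * ln (real n)" "real t * q * \<mu>" f t] f \<delta> ln_n_pos by simp
qed

text \<open>The threshold \<open>(1 - \<delta> / 2) ln n\<close> splits the gap between the mean
  weight and \<open>ln n\<close>: one half absorbs the fluctuations, the other makes the test set a
  negligible fraction of the vertices.\<close>

lemma d_TV_before:
  assumes \<delta>: "0 < \<delta>" "\<delta> < 1" and t: "real t \<le> (1 - \<delta>) * T"
  shows "(LINT \<omega>|iid_seq (step_pmf n p). d_TV n x\<^sub>0 t \<omega>) \<ge>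
    1 - 2 * log_dev / \<delta> - exp (- (\<delta> / 2) * ln (real n))"
proof -
  have T: "T \<ge> 0"
    using t_ent_ge \<mu>_pos ln_n_pos by (smt (verit) divide_pos_pos)
  have "real t * (q * \<mu>) \<le> (1 - \<delta>) * T * (q * \<mu>)"
    using t q_bounds \<mu>_pos by (intro mult_right_mono mult_nonneg_nonneg) auto
  then have c: "real t * q * \<mu> \<le> (1 - \<delta>) * ln (real n)"
    by (simp only: mult.assoc t_ent_eq)
  have "real t \<le> 3 * T"
    using t \<delta> T mult_right_mono[of "1 - \<delta>" 3 T] by linarith
  then have "hit_sum t (\<lambda>a. if a \<le> (1 - \<delta> / 2) * ln (real n) then 1 else 0) \<ge> 1 - 2 * log_dev / \<delta>"
    using \<delta>(1)
  proof (rule hit_sum_ge_tail)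
    fix a assume "\<bar>a - real t * q * \<mu>\<bar> < \<delta> / 2 * ln (real n)"
    then have "a < (1 - \<delta>) * ln (real n) + \<delta> / 2 * ln (real n)"
      using c by linarith
    then show "(if a \<le> (1 - \<delta> / 2) * ln (real n) then 1 else 0) = (1 :: real)"
      by (simp add: algebra_simps)
  qed simp
  then show ?thesis
    using expectation_d_TV_ge[of t "(1 - \<delta> / 2) * ln (real n)"]
    unfolding integral_d_TV exp_half_deviation by linarith
qed

text \<open>Mirror image with the threshold \<open>(1 + \<delta> / 2) ln n\<close>: the fluctuations
  rarely go below it, and \<open>n exp (- b)\<close> is a negative power of
  \<open>n\<close>.\<close>

lemma d_TV_after:
  assumes \<delta>: "0 < \<delta>" and t: "(1 + \<delta>) * T \<le> real t" "real t \<le> 3 * T" and \<theta>: "\<theta> > 0"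
  shows "(LINT \<omega>|iid_seq (step_pmf n p). d_TV n x\<^sub>0 t \<omega>) \<le> log_dev / \<delta> + \<theta> / 4 +
    (exp (- (\<delta> / 2) * ln (real n)) + 1 / (real n - 1) + 4 * log_dev / \<delta>) / (4 * \<theta>)"
proof -
  have "(1 + \<delta>) * T * (q * \<mu>) \<le> real t * (q * \<mu>)"
    using t q_bounds \<mu>_pos by (intro mult_right_mono mult_nonneg_nonneg) auto
  then have c: "(1 + \<delta>) * ln (real n) \<le> real t * q * \<mu>"
    by (simp only: mult.assoc t_ent_eq)
  let ?r = "1 - hit_sum t (\<lambda>a. if (1 + \<delta> / 2) * ln (real n) \<le> a then 1 else 0)"
  have r: "?r \<le> 2 * log_dev / \<delta>"
  proof -
    have "hit_sum t (\<lambda>a. if (1 + \<delta> / 2) * ln (real n) \<le> a then 1 else 0) \<ge> 1 - 2 * log_dev / \<delta>"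
      using t(2) \<delta>
    proof (rule hit_sum_ge_tail)
      fix a assume "\<bar>a - real t * q * \<mu>\<bar> < \<delta> / 2 * ln (real n)"
      then have "(1 + \<delta>) * ln (real n) - \<delta> / 2 * ln (real n) < a"
        using c by linarith
      then show "(if (1 + \<delta> / 2) * ln (real n) \<le> a then 1 else 0) = (1 :: real)"
        by (simp add: algebra_simps)
    qed simp
    then show ?thesis by linarith
  qed
  have "(LINT \<omega>|iid_seq (step_pmf n p). d_TV n x\<^sub>0 t \<omega>) \<le> ?r / 2 + \<theta> / 4 +
    (exp (- (\<delta> / 2) * ln (real n)) + 1 / (real n - 1) + 2 * ?r) / (4 * \<theta>)"
    using expectation_d_TV_le[OF \<theta>, of t "(1 + \<delta> / 2) * ln (real n)"]
    unfolding integral_d_TV exp_half_deviation .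
  also have "\<dots> \<le> (2 * log_dev / \<delta>) / 2 + \<theta> / 4 +
    (exp (- (\<delta> / 2) * ln (real n)) + 1 / (real n - 1) + 2 * (2 * log_dev / \<delta>)) / (4 * \<theta>)"
    using r \<theta> by (intro add_mono divide_right_mono mult_left_mono order_refl) auto
  finally show ?thesis by simp
qed

text \<open>The upper estimate, used with \<theta> equal to \<epsilon>, exhibits a time with
  distance below \<epsilon>; the lower estimate excludes every time before
  \<open>(1 - \<delta>) T\<close>. So the infimum is attained and lies in the window.\<close>

lemma t_mix_bounds:
  assumes \<delta>: "0 < \<delta>" "\<delta> < 1" and \<epsilon>: "0 < \<epsilon>"
    and "\<mu> / ln (real n) \<le> \<delta>"
    and before: "\<epsilon> \<le> 1 - 2 * log_dev / \<delta> - exp (- (\<delta> / 2) * ln (real n))"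
    and after: "log_dev / \<delta> + \<epsilon> / 4 +
      (exp (- (\<delta> / 2) * ln (real n)) + 1 / (real n - 1) + 4 * log_dev / \<delta>) / (4 * \<epsilon>) < \<epsilon>"
  shows "\<exists>m. t_mix n p x\<^sub>0 \<epsilon> = enat m \<and> (1 - \<delta>) * T \<le> real m \<and> real m \<le> (1 + 2 * \<delta>) * T"
proof -
  let ?G = "{t. (LINT \<omega>|iid_seq (step_pmf n p). d_TV n x\<^sub>0 t \<omega>) < \<epsilon>}"
  have "1 / \<delta> \<le> ln (real n) / \<mu>"
    using assms(4) \<delta> \<mu>_pos ln_n_pos by (simp add: field_simps)
  then have "1 / \<delta> \<le> T"
    using t_ent_ge by linarith
  then have \<delta>T: "1 \<le> \<delta> * T"
    using \<delta> by (simp add: field_simps)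
  then have T: "T > 0"
    using \<delta>(1) zero_less_mult_pos[of \<delta> T] by linarith
  \<comment> \<open>Rounding up costs at most 1, which is at most \<open>\<delta> T\<close>; this
    turns \<open>1 + \<delta>\<close> into \<open>1 + 2 \<delta>\<close>.\<close>
  define t where "t = nat \<lceil>(1 + \<delta>) * T\<rceil>"
  have pos: "(1 + \<delta>) * T \<ge> 0" using \<delta> T by simp
  have t: "(1 + \<delta>) * T \<le> real t" "real t \<le> (1 + \<delta>) * T + 1"
    using pos unfolding t_def by (auto intro: real_nat_ceiling_ge)
  have t2: "real t \<le> (1 + 2 * \<delta>) * T"
    using t(2) \<delta>T by (simp add: algebra_simps)
  also have "\<dots> \<le> 3 * T"
    using \<delta> T by (intro mult_right_mono) auto
  finally have t3: "real t \<le> 3 * T" .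
  have "t \<in> ?G"
    using d_TV_after[OF \<delta>(1) t(1) t3 \<epsilon>] after by simp
  then have mem: "(LEAST t. t \<in> ?G) \<in> ?G"
    by (rule LeastI)
  have least: "(LEAST t. t \<in> ?G) \<le> t"
    by (rule Least_le) fact
  define m where "m = (LEAST t. t \<in> ?G)"
  have "t_mix n p x\<^sub>0 \<epsilon> = enat m"
    unfolding t_mix_def
  proof (rule antisym)
    show "Inf (enat ` ?G) \<le> enat m"
      using mem by (intro Inf_lower) (auto simp: m_def)
    show "enat m \<le> Inf (enat ` ?G)"
      by (intro Inf_greatest) (auto simp: m_def intro: Least_le)
  qed
  moreover have "(1 - \<delta>) * T \<le> real m"
  proof (rule ccontr)
    assume "\<not> ?thesis"
    then have "\<epsilon> \<le> (LINT \<omega>|iid_seq (step_pmf n p). d_TV n x\<^sub>0 m \<omega>)"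
      using d_TV_before[OF \<delta>, of m] before by simp
    with mem show False by (simp add: m_def)
  qed
  moreover have "real m \<le> (1 + 2 * \<delta>) * T"
    using least t2 unfolding m_def[symmetric] by linarith
  ultimately show ?thesis by blast
qed

end

end

section \<open>Passage to the limit\<close>

theorem theorem2p7:
  fixes X :: "nat \<Rightarrow> nat pmf" and x\<^sub>0 :: "nat \<Rightarrow> nat"
  assumes X_range: "\<And>n. n \<ge> 2 \<Longrightarrow> set_pmf (X n) \<subseteq> {2..n}"
    and x0_range: "\<And>n. n \<ge> 2 \<Longrightarrow> x\<^sub>0 n \<in> {1..n}"
    and mu_small: "(\<lambda>n. mean_log_biased (X n) / ln (real n)) \<longlonglongrightarrow> 0"
    and wlln: "\<And>\<delta>::real. \<delta> > 0 \<Longrightarrow>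
      (\<lambda>n. measure (iid_seq (size_biased (X n)))
         {Y \<in> space (iid_seq (size_biased (X n))).
            \<bar>(1 / ln (real n)) *
              (\<Sum>s\<in>{1..nat \<lfloor>ln (real n) / mean_log_biased (X n)\<rfloor>}.
                 ln (real (Y s)) - mean_log_biased (X n))\<bar> > \<delta>}) \<longlonglongrightarrow> 0"
  shows "\<forall>\<epsilon>::real. 0 < \<epsilon> \<and> \<epsilon> < 1 \<longrightarrow>
    (\<lambda>n. ereal_of_enat (t_mix n (X n) (x\<^sub>0 n) \<epsilon>) / ereal (t_ent n (X n))) \<longlonglongrightarrow> 1"
proof (intro allI impI)
  fix \<epsilon> :: real assume \<epsilon>: "0 < \<epsilon> \<and> \<epsilon> < 1"
  have model: "block_average n (X n) (x\<^sub>0 n)" if "n \<ge> 2" for n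
    using that X_range x0_range by unfold_locales auto
  define dev where "dev = (\<lambda>n. block_average.rel_dev n (X n))"
  define ldev where "ldev = (\<lambda>n. block_average.log_dev n (X n))"
  have ldev_eq: "ldev n = 7 * dev n + 2 * sqrt (mean_log_biased (X n) / ln (real n))" if "n \<ge> 2" for n
    unfolding ldev_def dev_def by (rule block_average.log_dev_def[OF model[OF that]])
  have "dev \<longlonglongrightarrow> 0"
  proof (rule tendstoI)
    fix e :: real assume e: "e > 0"
    \<comment> \<open>With these choices \<open>rel_dev_le\<close> yields at most
      \<open>2 e / 8 + 2 e / 4 = 3 e / 4\<close>.\<close>
    then have "\<forall>\<^sub>F n in sequentially. measure (iid_seq (size_biased (X n)))
         {Y \<in> space (iid_seq (size_biased (X n))).
            \<bar>(1 / ln (real n)) *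
              (\<Sum>s\<in>{1..nat \<lfloor>ln (real n) / mean_log_biased (X n)\<rfloor>}.
                 ln (real (Y s)) - mean_log_biased (X n))\<bar> > e / 8} < e / 4"
      using wlln[of "e / 8"] by (intro order_tendstoD(2)[where y = 0]) auto
    with eventually_ge_at_top[of 2] show "\<forall>\<^sub>F n in sequentially. dist (dev n) 0 < e"
    proof eventually_elim
      case (elim n)
      interpret block_average n "X n" "x\<^sub>0 n" by (rule model) fact
      have "rel_dev \<ge> 0"
        unfolding rel_dev_def using ln_n_pos size.abs_dev_nonneg by simp
      moreover have "rel_dev < e"
        using rel_dev_le[of "e / 8"] elim(2) e unfolding K_def by simp
      ultimately show ?case
        by (simp add: dev_def)
    qed
  qed
  then have "(\<lambda>n. 7 * dev n + 2 * sqrt (mean_log_biased (X n) / ln (real n))) \<longlonglongrightarrow> 7 * 0 + 2 * sqrt 0"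
    by (intro tendsto_intros mu_small)
  then have "(\<lambda>n. 7 * dev n + 2 * sqrt (mean_log_biased (X n) / ln (real n))) \<longlonglongrightarrow> 0"
    by simp
  then have ldev0: "ldev \<longlonglongrightarrow> 0"
    by (rule Lim_transform_eventually)
      (use eventually_ge_at_top[of 2] in \<open>eventually_elim, simp add: ldev_eq\<close>)
  have bounds: "\<forall>\<^sub>F n in sequentially. \<exists>m. t_mix n (X n) (x\<^sub>0 n) \<epsilon> = enat m \<and> t_ent n (X n) > 0 \<and>
      (1 - \<delta>) * t_ent n (X n) \<le> real m \<and> real m \<le> (1 + 2 * \<delta>) * t_ent n (X n)"
    if \<delta>: "0 < \<delta>" "\<delta> < 1" for \<delta>
  proof -
    have ex: "(\<lambda>n. exp (- (\<delta> / 2) * ln (real n))) \<longlonglongrightarrow> 0"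
      using \<delta> by real_asymp
    have inv: "(\<lambda>n. 1 / (real n - 1)) \<longlonglongrightarrow> 0"
      by real_asymp
    have "(\<lambda>n. 1 - 2 * ldev n / \<delta> - exp (- (\<delta> / 2) * ln (real n))) \<longlonglongrightarrow> 1 - 2 * 0 / \<delta> - 0"
      using \<delta> by (intro tendsto_intros ldev0 ex) auto
    then have before: "\<forall>\<^sub>F n in sequentially. \<epsilon> < 1 - 2 * ldev n / \<delta> - exp (- (\<delta> / 2) * ln (real n))"
      by (rule order_tendstoD) (use \<epsilon> in simp)
    \<comment> \<open>Everything except \<open>\<epsilon> / 4\<close> vanishes in the limit, which
      leaves room below \<epsilon>.\<close>
    have "(\<lambda>n. ldev n / \<delta> + \<epsilon> / 4 +
        (exp (- (\<delta> / 2) * ln (real n)) + 1 / (real n - 1) + 4 * ldev n / \<delta>) / (4 * \<epsilon>))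
        \<longlonglongrightarrow> 0 / \<delta> + \<epsilon> / 4 + (0 + 0 + 4 * 0 / \<delta>) / (4 * \<epsilon>)"
      using \<delta> \<epsilon> by (intro tendsto_intros ldev0 ex inv) auto
    then have after: "\<forall>\<^sub>F n in sequentially. ldev n / \<delta> + \<epsilon> / 4 +
        (exp (- (\<delta> / 2) * ln (real n)) + 1 / (real n - 1) + 4 * ldev n / \<delta>) / (4 * \<epsilon>) < \<epsilon>"
      by (rule order_tendstoD) (use \<epsilon> in simp)
    \<comment> \<open>The bound \<delta> pays for rounding the time to an integer, the bound
      \<open>1 / 2\<close> for the floor in \<open>K\<close>.\<close>
    have "\<forall>\<^sub>F n in sequentially. mean_log_biased (X n) / ln (real n) < min \<delta> (1 / 2)"
      using mu_small by (rule order_tendstoD) (use \<delta> in simp)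
    with eventually_ge_at_top[of 2] before after show ?thesis
    proof eventually_elim
      case (elim n)
      interpret block_average n "X n" "x\<^sub>0 n" by (rule model) fact
      have "0 < ln (real n) / \<mu>"
        using ln_n_pos \<mu>_pos by simp
      then have "T > 0"
        using t_ent_ge by linarith
      then show ?case
        using t_mix_bounds[of \<delta> \<epsilon>] elim \<delta> \<epsilon> unfolding ldev_def by simp
    qed
  qed
  \<comment> \<open>Convergence is shown first over the reals; \<open>bounds\<close> makes the
    mixing time finite eventually, so \<open>the_enat\<close> then returns its true value.\<close>
  have "(\<lambda>n. real (the_enat (t_mix n (X n) (x\<^sub>0 n) \<epsilon>)) / t_ent n (X n)) \<longlonglongrightarrow> 1"
  proof (rule tendstoI)
    fix e :: real assume "e > 0"
    define \<delta> where "\<delta> = min (e / 4) (1 / 2)"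
    have \<delta>: "0 < \<delta>" "\<delta> < 1" "2 * \<delta> < e"
      using \<open>e > 0\<close> by (auto simp: \<delta>_def)
    from bounds[OF \<delta>(1,2)]
    show "\<forall>\<^sub>F n in sequentially. dist (real (the_enat (t_mix n (X n) (x\<^sub>0 n) \<epsilon>)) / t_ent n (X n)) 1 < e"
    proof eventually_elim
      case (elim n)
      then obtain m where m: "t_mix n (X n) (x\<^sub>0 n) \<epsilon> = enat m" "t_ent n (X n) > 0"
        "(1 - \<delta>) * t_ent n (X n) \<le> real m" "real m \<le> (1 + 2 * \<delta>) * t_ent n (X n)" by blast
      then have "1 - \<delta> \<le> real m / t_ent n (X n)" "real m / t_ent n (X n) \<le> 1 + 2 * \<delta>"
        by (simp_all add: pos_le_divide_eq pos_divide_le_eq)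
      then show ?case
        using \<delta> m(1) by (simp add: dist_real_def abs_less_iff)
    qed
  qed
  then have "(\<lambda>n. ereal (real (the_enat (t_mix n (X n) (x\<^sub>0 n) \<epsilon>)) / t_ent n (X n))) \<longlonglongrightarrow> ereal 1"
    by (rule tendsto_ereal)
  then show "(\<lambda>n. ereal_of_enat (t_mix n (X n) (x\<^sub>0 n) \<epsilon>) / ereal (t_ent n (X n))) \<longlonglongrightarrow> 1"
    unfolding one_ereal_def
  proof (rule Lim_transform_eventually)
    show "\<forall>\<^sub>F n in sequentially. ereal (real (the_enat (t_mix n (X n) (x\<^sub>0 n) \<epsilon>)) / t_ent n (X n)) =
      ereal_of_enat (t_mix n (X n) (x\<^sub>0 n) \<epsilon>) / ereal (t_ent n (X n))"
      using bounds[of "1 / 2"] by (rule eventually_mono) auto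
  qed
qed

end
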